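(* Let $R$ be a commutative domain of characteristic zero containing $\mathbb{Q}$, $d$ a nonzero derivation of $R$, $\delta=\frac12d$, and let $\Gamma$ be a group acting (on the right) by automorphisms on $C=R(\!(y;\delta)\!)_2$ and stabilizing $R$. Denote by $s$ the $1$-cocycle in $Z^1(\Gamma,U(R))$ defined by $y\cdot\gamma=s_\gamma^{-1}y+\cdots$ (terms of higher $y$-valuation) for any $\gamma\in\Gamma$. Assume that there exists in $C^{\Gamma}$ an element of the form $w=e^2y^{-2}+h$ with $h\in R$ and $e\in U(R)$ such that $e\cdot\gamma=s_\gamma^{-1}e$ for any $\gamma\in\Gamma$. Then the derivation $\Delta=e^2\delta$ restricts to a derivation of $R^{\Gamma}$ and, denoting by $v$ the square root of $w^{-1}$ in $C$ whose development starts with $v=e^{-1}y+\cdots$, we have $$C^{\Gamma}=R^{\Gamma}(\!(v;\Delta)\!)_2.$$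
   Context: $U(R)$ is the group of invertible elements of $R$. For a commutative ring $S\supseteq\mathbb{Q}$ with a derivation $\delta$ (possibly zero), $S(\!(y;\delta)\!)_2$ is the ring of Laurent series $\sum_{i\ge m}f_iy^i$ ($m\in\mathbb{Z}$, $f_i\in S$) with multiplication determined by $yf=\sum_{k\ge0}\frac{(2k)!}{2^k(k!)^2}\delta^k(f)y^{2k+1}$ for $f\in S$. $\Gamma$ stabilizes $R$ means that each $\gamma\in\Gamma$ restricts to an automorphism of $R$. $R^\Gamma$ and $C^\Gamma$ are the subrings of $\Gamma$-invariants. $Z^1(\Gamma,U(R))$ is the group of maps $s:\Gamma\to U(R)$ with $s_{\gamma\gamma'}=(s_\gamma\cdot\gamma')s_{\gamma'}$ for all $\gamma,\gamma'\in\Gamma$. Each automorphism of $C$ stabilizing $R$ preserves the $y$-valuation (smallest exponent with nonzero coefficient), so that $y\cdot\gamma$ has the form $s_\gamma^{-1}y+\cdots$ with $s_\gamma\in U(R)$. An element $\sum_{i\geq 2}g_iy^i$ of $C$ with $g_2=\epsilon^2$, $\epsilon\in U(R)$, has a unique square root in $C$ of the form $\epsilon y+\cdots$. *)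

theory Defs
  imports Complex_Main "HOL-Algebra.QuotRing"
begin

definition derivation_on :: "'a::comm_ring_1 set \<Rightarrow> ('a \<Rightarrow> 'a) \<Rightarrow> bool" where
  "derivation_on S D \<longleftrightarrow>
     (\<forall>a\<in>S. D a \<in> S) \<and>
     (\<forall>a\<in>S. \<forall>b\<in>S. D (a + b) = D a + D b) \<and>
     (\<forall>a\<in>S. \<forall>b\<in>S. D (a * b) = D a * b + a * D b)"

(* Only meaningful on units. *)
definition unit_inv :: "'a::comm_ring_1 \<Rightarrow> 'a" where
  "unit_inv a = (THE b. a * b = 1)"

(* The rule y f = (\<Sum>k. (2k)! / (2^k (k!)^2) \<delta>^k(f) y^(2k+1)) says, as operators on coefficients,
   y f = (1 - 2 \<delta> y^2)^(-1/2) (f) y.  Iterating it (and inverting, for negative exponents) gives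
   y^n f = (1 - 2 \<delta> y^2)^(-n/2) (f) y^n = (\<Sum>k. c(n,k) \<delta>^k(f) y^(n+2k)) for every integer n, where
   c(n,k) = n (n+2) ... (n+2k-2) / k!.  The rational number c(n,k) is taken in the coefficient
   ring, hence the description by its characteristic equation.  Lemmas skew_coeff_one and
   y_times_const recover the rule for y f, and skew_mult_const_left, skew_mult_y_power_right and
   skew_laurent_ring show that the product is a ring structure in which f i y^i is the product of
   the constant f i and the i-th power of y. *)
definition skew_coeff :: "int \<Rightarrow> nat \<Rightarrow> 'a::{idom, ring_char_0}" where
  "skew_coeff n k = (THE c. fact k * c = (\<Prod>j<k. of_int (n + 2 * int j)))"

(* A function f on the integers stands for the series (\<Sum>i. f i y^i), coefficients on the left.
   If f and g vanish below some exponent, the index set is finite. *)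
definition skew_mult :: "('a::{idom, ring_char_0} \<Rightarrow> 'a) \<Rightarrow> (int \<Rightarrow> 'a) \<Rightarrow> (int \<Rightarrow> 'a) \<Rightarrow> int \<Rightarrow> 'a" where
  "skew_mult \<delta> f g n =
     (\<Sum>(i, j, k) \<in> {(i, j, k). f i \<noteq> 0 \<and> g j \<noteq> 0 \<and> i + j + 2 * int k = n}.
        f i * skew_coeff i k * (\<delta> ^^ k) (g j))"

(* skew_laurent S D is S((y; D))_2, for a subring S of the ambient ring that contains the
   rational numbers and is stable under D. *)
definition skew_laurent :: "'a::{idom, ring_char_0} set \<Rightarrow> ('a \<Rightarrow> 'a) \<Rightarrow> (int \<Rightarrow> 'a) ring" where
  "skew_laurent S D =
     \<lparr>carrier = {f. range f \<subseteq> S \<and> (\<exists>m. \<forall>i<m. f i = 0)},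
      monoid.mult = skew_mult D,
      one = (\<lambda>n. if n = 0 then 1 else 0),
      zero = (\<lambda>_. 0),
      add = (\<lambda>f g n. f n + g n)\<rparr>"

(* a y^m *)
definition lmonom :: "'a::zero \<Rightarrow> int \<Rightarrow> int \<Rightarrow> 'a" where
  "lmonom a m = (\<lambda>n. if n = m then a else 0)"

abbreviation lconst :: "'a::zero \<Rightarrow> int \<Rightarrow> 'a" where
  "lconst a \<equiv> lmonom a 0"

(* f = a y^m + (terms of exponent > m) *)
definition starts_with :: "(int \<Rightarrow> 'a::zero) \<Rightarrow> 'a \<Rightarrow> int \<Rightarrow> bool" where
  "starts_with f a m \<longleftrightarrow> f m = a \<and> (\<forall>i<m. f i = 0)"

definition right_action_by_automorphisms ::
  "('g, 'h) monoid_scheme \<Rightarrow> ('c, 'd) ring_scheme \<Rightarrow> ('c \<Rightarrow> 'g \<Rightarrow> 'c) \<Rightarrow> bool" where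
  "right_action_by_automorphisms G C act \<longleftrightarrow>
     (\<forall>\<gamma>\<in>carrier G. (\<lambda>f. act f \<gamma>) \<in> ring_iso C C) \<and>
     (\<forall>f\<in>carrier C. act f \<one>\<^bsub>G\<^esub> = f) \<and>
     (\<forall>f\<in>carrier C. \<forall>\<gamma>\<in>carrier G. \<forall>\<gamma>'\<in>carrier G. act f (\<gamma> \<otimes>\<^bsub>G\<^esub> \<gamma>') = act (act f \<gamma>) \<gamma>')"

definition stabilizes ::
  "('g, 'h) monoid_scheme \<Rightarrow> ('c, 'd) ring_scheme \<Rightarrow> ('c \<Rightarrow> 'g \<Rightarrow> 'c) \<Rightarrow> 'c set \<Rightarrow> bool" where
  "stabilizes G C act K \<longleftrightarrow>
     (\<forall>\<gamma>\<in>carrier G. (\<lambda>f. act f \<gamma>) \<in> ring_iso (C\<lparr>carrier := K\<rparr>) (C\<lparr>carrier := K\<rparr>))"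

definition invariants ::
  "('g, 'h) monoid_scheme \<Rightarrow> ('c, 'd) ring_scheme \<Rightarrow> ('c \<Rightarrow> 'g \<Rightarrow> 'c) \<Rightarrow> 'c set" where
  "invariants G C act = {f \<in> carrier C. \<forall>\<gamma>\<in>carrier G. act f \<gamma> = f}"

definition coeff_invariants ::
  "('g, 'h) monoid_scheme \<Rightarrow> ((int \<Rightarrow> 'a::zero) \<Rightarrow> 'g \<Rightarrow> int \<Rightarrow> 'a) \<Rightarrow> 'a set" where
  "coeff_invariants G act = {r. \<forall>\<gamma>\<in>carrier G. act (lconst r) \<gamma> = lconst r}"

definition leading_cocycle :: "((int \<Rightarrow> 'a::comm_ring_1) \<Rightarrow> 'g \<Rightarrow> int \<Rightarrow> 'a) \<Rightarrow> 'g \<Rightarrow> 'a" where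
  "leading_cocycle act \<gamma> = (THE u. u dvd 1 \<and> starts_with (act (lmonom 1 1) \<gamma>) (unit_inv u) 1)"

definition sqrt_starting_with ::
  "(int \<Rightarrow> 'a::zero, 'd) ring_scheme \<Rightarrow> 'a \<Rightarrow> (int \<Rightarrow> 'a) \<Rightarrow> int \<Rightarrow> 'a" where
  "sqrt_starting_with C a g = (THE v. v \<in> carrier C \<and> v \<otimes>\<^bsub>C\<^esub> v = g \<and> starts_with v a 1)"

(* The sum (\<Sum>i. f i v^i) in C, for v of valuation 1: it is computed coefficient by coefficient,
   each coefficient being a sum with finitely many nonzero terms. *)
definition laurent_subst ::
  "(int \<Rightarrow> 'a::comm_monoid_add, 'd) ring_scheme \<Rightarrow> (int \<Rightarrow> 'a) \<Rightarrow> (int \<Rightarrow> 'a) \<Rightarrow> int \<Rightarrow> 'a" where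
  "laurent_subst C v f n =
     (\<Sum>i \<in> {i. (lconst (f i) \<otimes>\<^bsub>C\<^esub> v [^]\<^bsub>C\<^esub> i) n \<noteq> 0}. (lconst (f i) \<otimes>\<^bsub>C\<^esub> v [^]\<^bsub>C\<^esub> i) n)"

definition rational_subring :: "'a::comm_ring_1 set \<Rightarrow> bool" where
  "rational_subring S \<longleftrightarrow>
     1 \<in> S \<and> (\<forall>a\<in>S. \<forall>b\<in>S. a - b \<in> S \<and> a * b \<in> S) \<and>
     (\<forall>n::nat. n > 0 \<longrightarrow> (\<exists>b\<in>S. of_nat n * b = 1))"

lemma rational_subringD:
  assumes "rational_subring S"
  shows "0 \<in> S" "1 \<in> S" "a \<in> S \<Longrightarrow> b \<in> S \<Longrightarrow> a - b \<in> S" "a \<in> S \<Longrightarrow> b \<in> S \<Longrightarrow> a + b \<in> S"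
    "a \<in> S \<Longrightarrow> - a \<in> S" "a \<in> S \<Longrightarrow> b \<in> S \<Longrightarrow> a * b \<in> S" "of_nat n \<in> S" "of_int z \<in> S"
proof -
  have 1: "1 \<in> S" and D: "\<And>a b. a \<in> S \<Longrightarrow> b \<in> S \<Longrightarrow> a - b \<in> S"
    and M: "\<And>a b. a \<in> S \<Longrightarrow> b \<in> S \<Longrightarrow> a * b \<in> S"
    using assms unfolding rational_subring_def by auto
  have 0: "0 \<in> S" using D[OF 1 1] by simp
  have U: "- a \<in> S" if "a \<in> S" for a using D[OF 0 that] by simp
  have A: "a + b \<in> S" if "a \<in> S" "b \<in> S" for a b using D[OF that(1) U[OF that(2)]] by simp
  have N: "of_nat n \<in> S" for n by (induction n) (auto simp: 0 1 A)
  have Z: "of_int z \<in> S" for z by (cases z rule: int_cases2) (use N U in auto)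
  show "0 \<in> S" by (rule 0)
  show "1 \<in> S" by (rule 1)
  show "a \<in> S \<Longrightarrow> b \<in> S \<Longrightarrow> a - b \<in> S" by (rule D)
  show "a \<in> S \<Longrightarrow> b \<in> S \<Longrightarrow> a + b \<in> S" by (rule A)
  show "a \<in> S \<Longrightarrow> - a \<in> S" by (rule U)
  show "a \<in> S \<Longrightarrow> b \<in> S \<Longrightarrow> a * b \<in> S" by (rule M)
  show "of_nat n \<in> S" by (rule N)
  show "of_int z \<in> S" by (rule Z)
qed

locale skew_base =
  fixes S :: "'a::{idom, ring_char_0} set" and D :: "'a \<Rightarrow> 'a"
  assumes S: "rational_subring S" and D: "derivation_on S D"
begin

lemmas S_simps [simp, intro] = rational_subringD[OF S]

lemma S_sum: "(\<And>x. x \<in> A \<Longrightarrow> f x \<in> S) \<Longrightarrow> sum f A \<in> S"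
  by (induction A rule: infinite_finite_induct) auto

lemma D_closed [simp, intro]: "a \<in> S \<Longrightarrow> D a \<in> S"
  and D_add: "a \<in> S \<Longrightarrow> b \<in> S \<Longrightarrow> D (a + b) = D a + D b"
  and D_mult: "a \<in> S \<Longrightarrow> b \<in> S \<Longrightarrow> D (a * b) = D a * b + a * D b"
  using D unfolding derivation_on_def by auto

lemma D_0 [simp]: "D 0 = 0"
  using D_add[of 0 0] by simp

lemma D_1 [simp]: "D 1 = 0"
  using D_mult[of 1 1] by simp

lemma Dn_closed [simp, intro]: "a \<in> S \<Longrightarrow> (D ^^ k) a \<in> S"
  by (induction k) auto

lemma Dn_0 [simp]: "(D ^^ k) 0 = 0"
  by (induction k) auto

lemma Dn_add: "a \<in> S \<Longrightarrow> b \<in> S \<Longrightarrow> (D ^^ k) (a + b) = (D ^^ k) a + (D ^^ k) b"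
  by (induction k) (auto simp: D_add)

lemma D_sum: "(\<And>x. x \<in> A \<Longrightarrow> f x \<in> S) \<Longrightarrow> D (sum f A) = (\<Sum>x\<in>A. D (f x))"
  by (induction A rule: infinite_finite_induct) (auto simp: D_add S_sum)

lemma Dn_sum: "(\<And>x. x \<in> A \<Longrightarrow> f x \<in> S) \<Longrightarrow> (D ^^ k) (sum f A) = (\<Sum>x\<in>A. (D ^^ k) (f x))"
  by (induction A rule: infinite_finite_induct) (auto simp: Dn_add S_sum)

lemma D_of_nat [simp]: "D (of_nat n) = 0"
  by (induction n) (auto simp: D_add)

lemma D_of_int [simp]: "D (of_int n) = 0"
proof -
  have "D (of_int n + of_int (- n)) = D (of_int n) + D (of_int (- n))" for n by (rule D_add) auto
  then have neg: "D (of_int (- n)) = - D (of_int n)" for n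
    by (simp add: eq_neg_iff_add_eq_0 add.commute)
  show ?thesis
  proof (cases n rule: int_cases2)
    case (nonpos m)
    then show ?thesis using neg[of "int m"] by simp
  qed simp
qed

lemma fact_unit: "\<exists>b\<in>S. fact k * b = 1"
  using S unfolding rational_subring_def by (metis fact_gt_zero of_nat_fact)

lemma skew_coeff_char: "fact k * skew_coeff n k = (\<Prod>j<k. of_int (n + 2 * int j) :: 'a)"
  and skew_coeff_in [simp, intro]: "skew_coeff n k \<in> S"
proof -
  obtain b where b: "b \<in> S" "fact k * b = (1 :: 'a)" using fact_unit by blast
  let ?p = "(\<Prod>j<k. of_int (n + 2 * int j) :: 'a)"
  have eq: "skew_coeff n k = b * ?p" unfolding skew_coeff_def
  proof (rule the_equality)
    show "fact k * (b * ?p) = ?p" using b(2) by (simp add: mult.assoc[symmetric])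
    fix c assume c: "fact k * c = ?p"
    have "b * ?p = (fact k * b) * c" unfolding c[symmetric] by (simp only: mult_ac)
    then show "c = b * ?p" using b(2) by simp
  qed
  show "fact k * skew_coeff n k = ?p" unfolding eq using b(2) by (simp add: mult.assoc[symmetric])
  have "?p = of_int (\<Prod>j<k. n + 2 * int j)" by simp
  then show "skew_coeff n k \<in> S" unfolding eq using b(1) by (metis S_simps(6,8))
qed

lemma skew_coeff_0 [simp]: "skew_coeff n 0 = (1::'a)"
  using skew_coeff_char[of 0 n] by simp

lemma skew_coeff_zero [simp]: "k > 0 \<Longrightarrow> skew_coeff 0 k = (0::'a)"
proof -
  assume "k > 0"
  then have "(\<Prod>j<k. of_int (0 + 2 * int j) :: 'a) = 0" by (intro prod_zero) auto
  then show ?thesis using skew_coeff_char[of k 0] by (metis fact_nonzero mult_eq_0_iff)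
qed

lemma skew_coeff_one: "2 ^ k * (fact k)\<^sup>2 * skew_coeff 1 k = (fact (2 * k) :: 'a)"
proof -
  have "2 ^ k * fact k * (\<Prod>j<k. of_int (1 + 2 * int j)) = (fact (2 * k) :: 'a)"
  proof (induction k)
    case (Suc k)
    have "2 ^ Suc k * fact (Suc k) * (\<Prod>j<Suc k. of_int (1 + 2 * int j) :: 'a)
      = (2 * (of_nat k + 1) * (2 * of_nat k + 1)) * (2 ^ k * fact k * (\<Prod>j<k. of_int (1 + 2 * int j)))"
      by (simp add: algebra_simps)
    also have "\<dots> = (2 * of_nat k + 2) * ((2 * of_nat k + 1) * fact (2 * k))"
      unfolding Suc by (simp add: algebra_simps)
    also have "\<dots> = fact (2 * Suc k)" by (simp add: algebra_simps)
    finally show ?case .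
  qed simp
  then show ?thesis unfolding skew_coeff_char[symmetric] by (simp add: power2_eq_square mult_ac)
qed

lemma D_skew_coeff [simp]: "D (skew_coeff n k) = 0"
proof -
  have "D (fact k * skew_coeff n k) = D (of_int (\<Prod>j<k. n + 2 * int j))"
    using skew_coeff_char[of k n] by simp
  moreover have "D (fact k * skew_coeff n k) = fact k * D (skew_coeff n k)"
  proof -
    have f: "fact k = (of_nat (fact k) :: 'a)" by simp
    show ?thesis unfolding f
      using D_mult[OF S_simps(7) skew_coeff_in, of "fact k" n k] by (simp del: of_nat_fact)
  qed
  ultimately show ?thesis by (simp del: of_int_prod)
qed

lemma Dn_skew_coeff: "a \<in> S \<Longrightarrow> (D ^^ l) (skew_coeff n k * a) = skew_coeff n k * (D ^^ l) a"
  by (induction l) (auto simp: D_mult)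

lemma Dn_mult:
  assumes "a \<in> S" "b \<in> S"
  shows "(D ^^ p) (a * b) = (\<Sum>r\<le>p. of_nat (p choose r) * (D ^^ r) a * (D ^^ (p - r)) b)"
proof (induction p)
  case (Suc p)
  have N: "D (of_nat m * x) = of_nat m * D x" if "x \<in> S" for m x
    using D_mult[of "of_nat m" x] that by simp
  let ?t = "\<lambda>r q. (D ^^ r) a * (D ^^ q) b"
  have "(D ^^ Suc p) (a * b) = (\<Sum>r\<le>p. D (of_nat (p choose r) * ?t r (p - r)))"
    using assms by (simp add: Suc D_sum mult.assoc)
  also have "\<dots> = (\<Sum>r\<le>p. of_nat (p choose r) * ?t (Suc r) (p - r))
      + (\<Sum>r\<le>p. of_nat (p choose r) * ?t r (Suc p - r))"
    using assms by (simp add: N D_mult sum.distrib[symmetric] algebra_simps Suc_diff_le)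
  also have "(\<Sum>r\<le>p. of_nat (p choose r) * ?t r (Suc p - r))
      = (\<Sum>r\<le>Suc p. of_nat (p choose r) * ?t r (Suc p - r))" by simp
  also have "\<dots> = ?t 0 (Suc p) + (\<Sum>r\<le>p. of_nat (p choose Suc r) * ?t (Suc r) (p - r))"
    by (subst sum.atMost_Suc_shift) simp
  finally show ?case
    by (subst sum.atMost_Suc_shift) (simp add: sum.distrib[symmetric] algebra_simps)
qed simp

lemma skew_coeff_split:
  "skew_coeff n p * skew_coeff (n + 2 * int p) q = of_nat ((p + q) choose p) * (skew_coeff n (p + q) :: 'a)"
proof -
  have P: "(\<Prod>j<p + q. of_int (n + 2 * int j) :: 'a)
     = (\<Prod>j<p. of_int (n + 2 * int j)) * (\<Prod>j<q. of_int (n + 2 * int p + 2 * int j))"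
    by (induction q) (simp_all add: algebra_simps)
  have F: "fact (p + q) = fact p * fact q * (of_nat ((p + q) choose p) :: 'a)"
    using binomial_fact_lemma[of p "p + q"]
    by (metis add_diff_cancel_left' le_add1 of_nat_fact of_nat_mult)
  have "fact p * fact q * (skew_coeff n p * skew_coeff (n + 2 * int p) q :: 'a)
     = (fact p * skew_coeff n p) * (fact q * skew_coeff (n + 2 * int p) q)" by (simp only: mult_ac)
  also have "\<dots> = fact (p + q) * skew_coeff n (p + q)"
    unfolding skew_coeff_char P by simp
  finally show ?thesis unfolding F mult.assoc by simp
qed

lemma skew_coeff_Vandermonde:
  "(skew_coeff (a + b) m :: 'a) = (\<Sum>k\<le>m. skew_coeff a k * skew_coeff b (m - k))"
proof -
  define P where "P = (\<lambda>(n::int) k. \<Prod>j<k. n + 2 * int j)"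
  have PP: "rat_of_int (P n k) = 2 ^ k * pochhammer (of_int n / 2) k" for n k
    unfolding P_def by (induction k) (simp_all add: pochhammer_Suc field_simps)
  have "rat_of_int (P (a + b) m) = rat_of_int (\<Sum>k\<le>m. int (m choose k) * P a k * P b (m - k))"
  proof -
    have "rat_of_int (P (a + b) m) = 2 ^ m * pochhammer (of_int a / 2 + of_int b / 2) m"
      unfolding PP by (simp add: add_divide_distrib)
    also have "\<dots> = (\<Sum>k\<le>m. of_nat (m choose k) * (2 ^ k * pochhammer (of_int a / 2) k)
        * (2 ^ (m - k) * pochhammer (of_int b / 2) (m - k)))"
      unfolding pochhammer_binomial_sum sum_distrib_left
    proof (rule sum.cong, goal_cases)
      case (2 k)
      then have "(2::rat) ^ m = 2 ^ k * 2 ^ (m - k)" by (simp flip: power_add)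
      then show ?case by simp
    qed simp
    finally show ?thesis by (simp add: PP)
  qed
  then have V: "P (a + b) m = (\<Sum>k\<le>m. int (m choose k) * P a k * P b (m - k))" by (simp only: of_int_eq_iff)
  have C: "fact k * skew_coeff n k = (of_int (P n k) :: 'a)" for n k
    unfolding skew_coeff_char P_def by simp
  have "fact m * (\<Sum>k\<le>m. skew_coeff a k * skew_coeff b (m - k))
     = (\<Sum>k\<le>m. of_nat (m choose k) * of_int (P a k) * (of_int (P b (m - k)) :: 'a))"
    unfolding sum_distrib_left
  proof (rule sum.cong, goal_cases)
    case (2 k)
    then have "fact m = fact k * fact (m - k) * (of_nat (m choose k) :: 'a)"
      using binomial_fact_lemma[of k m] by (metis atMost_iff of_nat_fact of_nat_mult)
    then show ?case by (simp add: C[symmetric] mult_ac)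
  qed simp
  also have "\<dots> = fact m * skew_coeff (a + b) m" unfolding C V by simp
  finally show ?thesis by simp
qed

lemma skew_assoc_core:
  assumes "g \<in> S" "h \<in> S"
  shows "(\<Sum>k\<le>s. skew_coeff i k * (D ^^ k) g * (skew_coeff (i + j + 2 * int k) (s - k) * (D ^^ (s - k)) h))
    = (\<Sum>t\<le>s. skew_coeff i t * (skew_coeff j (s - t) * (D ^^ t) (g * (D ^^ (s - t)) h)))"
proof -
  have "(\<Sum>t\<le>s. skew_coeff i t * (skew_coeff j (s - t) * (D ^^ t) (g * (D ^^ (s - t)) h)))
    = (\<Sum>t\<le>s. \<Sum>k\<le>t. skew_coeff i t * (skew_coeff j (s - t)
         * (of_nat (t choose k) * (D ^^ k) g * (D ^^ (s - k)) h)))"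
  proof (intro sum.cong refl, goal_cases)
    case (1 t)
    have "(D ^^ (t - k)) ((D ^^ (s - t)) h) = (D ^^ (s - k)) h" if "k \<le> t" for k
      using that 1 by (simp add: funpow_add[symmetric, THEN fun_cong, unfolded o_def])
    then show ?case using assms by (subst Dn_mult) (auto simp: sum_distrib_left intro!: sum.cong)
  qed
  also have "\<dots> = (\<Sum>k\<le>s. \<Sum>q\<le>s - k. skew_coeff i (k + q) * (skew_coeff j (s - (k + q))
         * (of_nat ((k + q) choose k) * (D ^^ k) g * (D ^^ (s - k)) h)))"
    unfolding sum.Sigma[OF finite_atMost ballI[OF finite_atMost]]
    by (rule sum.reindex_bij_witness[of _ "\<lambda>(k, q). (k + q, k)" "\<lambda>(t, k). (k, t - k)"]) auto
  also have "\<dots> = (\<Sum>k\<le>s. skew_coeff i k * (D ^^ k) g *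
      ((\<Sum>q\<le>s - k. skew_coeff (i + 2 * int k) q * skew_coeff j (s - k - q)) * (D ^^ (s - k)) h))"
  proof (intro sum.cong refl, goal_cases)
    case (1 k)
    have "skew_coeff i (k + q) * (skew_coeff j (s - (k + q)) * (of_nat ((k + q) choose k) * x * y))
       = skew_coeff i k * x * (skew_coeff (i + 2 * int k) q * skew_coeff j (s - k - q) * y)" for q and x y :: 'a
    proof -
      have "skew_coeff i (k + q) * (skew_coeff j (s - (k + q)) * (of_nat ((k + q) choose k) * x * y))
        = (of_nat ((k + q) choose k) * skew_coeff i (k + q)) * skew_coeff j (s - k - q) * x * y"
        by (simp add: mult_ac)
      also have "\<dots> = (skew_coeff i k * skew_coeff (i + 2 * int k) q) * skew_coeff j (s - k - q) * x * y"
        by (simp only: skew_coeff_split)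
      finally show ?thesis by (simp add: mult_ac)
    qed
    then show ?case unfolding sum_distrib_right sum_distrib_left by (intro sum.cong refl)
  qed
  finally have *: "(\<Sum>t\<le>s. skew_coeff i t * (skew_coeff j (s - t) * (D ^^ t) (g * (D ^^ (s - t)) h)))
    = (\<Sum>k\<le>s. skew_coeff i k * (D ^^ k) g * (skew_coeff (i + 2 * int k + j) (s - k) * (D ^^ (s - k)) h))"
    unfolding skew_coeff_Vandermonde[symmetric] .
  have e: "i + j + 2 * int k = i + 2 * int k + j" for k by simp
  show ?thesis unfolding * e ..
qed

lemma skew_mult_index_finite:
  fixes f g :: "int \<Rightarrow> 'a"
  assumes "\<And>i. i < a \<Longrightarrow> f i = 0" "\<And>j. j < b \<Longrightarrow> g j = 0"
  shows "finite {(i, j, k). f i \<noteq> 0 \<and> g j \<noteq> 0 \<and> i + j + 2 * int k = n}"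
proof (rule finite_subset)
  show "{(i, j, k). f i \<noteq> 0 \<and> g j \<noteq> 0 \<and> i + j + 2 * int k = n}
      \<subseteq> {a..n - b} \<times> {b..n - a} \<times> {..nat (n - a - b)}"
  proof (rule subsetI)
    fix x assume "x \<in> {(i, j, k). f i \<noteq> 0 \<and> g j \<noteq> 0 \<and> i + j + 2 * int k = n}"
    then obtain i j k where x: "x = (i, j, k)" "f i \<noteq> 0" "g j \<noteq> 0" and n: "i + j + 2 * int k = n"
      by auto
    then have "a \<le> i" "b \<le> j" using assms(1)[of i] assms(2)[of j] by force+
    then show "x \<in> {a..n - b} \<times> {b..n - a} \<times> {..nat (n - a - b)}" using n unfolding x(1) by auto
  qed
qed simp

lemma skew_mult_box:
  assumes "\<And>i. i < a \<Longrightarrow> f i = 0" "\<And>j. j < b \<Longrightarrow> g j = 0"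
    and "finite I" "finite J" "{a..n - b} \<subseteq> I" "{b..n - a} \<subseteq> J" "nat (n - a - b) \<le> K"
  shows "skew_mult D f g n = (\<Sum>i\<in>I. \<Sum>j\<in>J. \<Sum>k\<le>K.
    if i + j + 2 * int k = n then f i * skew_coeff i k * (D ^^ k) (g j) else 0)"
proof -
  have "skew_mult D f g n = (\<Sum>(i, j, k) \<in> I \<times> J \<times> {..K}.
    if i + j + 2 * int k = n then f i * skew_coeff i k * (D ^^ k) (g j) else 0)"
    unfolding skew_mult_def
  proof (rule sum.mono_neutral_cong_left)
    show "{(i, j, k). f i \<noteq> 0 \<and> g j \<noteq> 0 \<and> i + j + 2 * int k = n} \<subseteq> I \<times> J \<times> {..K}"
    proof (rule subsetI)
      fix x assume "x \<in> {(i, j, k). f i \<noteq> 0 \<and> g j \<noteq> 0 \<and> i + j + 2 * int k = n}"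
      then obtain i j k where x: "x = (i, j, k)" "f i \<noteq> 0" "g j \<noteq> 0" and n: "i + j + 2 * int k = n"
        by auto
      then have "a \<le> i" "b \<le> j" using assms(1)[of i] assms(2)[of j] by force+
      then have "i \<in> {a..n - b}" "j \<in> {b..n - a}" "k \<le> nat (n - a - b)" using n by auto
      then show "x \<in> I \<times> J \<times> {..K}" using assms(5,6,7) unfolding x(1) by auto
    qed
  qed (use assms(3,4) in \<open>auto split: if_splits\<close>)
  then show ?thesis by (simp add: sum.cartesian_product split_def)
qed

lemma skew_mult_below:
  assumes "\<And>i. i < a \<Longrightarrow> f i = 0" "\<And>j. j < b \<Longrightarrow> g j = 0" "n < a + b"
  shows "skew_mult D f g n = 0"
  using assms by (subst skew_mult_box[where a = a and b = b and I = "{}" and J = "{}" and K = 0]) auto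

lemma double_sum_delta:
  fixes H :: "nat \<Rightarrow> nat \<Rightarrow> 'a"
  assumes "s \<le> K"
  shows "(\<Sum>k\<le>K. \<Sum>m\<le>K. if k + m = s then H k m else 0) = (\<Sum>k\<le>s. H k (s - k))"
proof -
  have "(\<Sum>m\<le>K. if k + m = s then H k m else 0) = (if k \<le> s then H k (s - k) else 0)" for k
  proof (cases "k \<le> s")
    case True
    then have "(\<Sum>m\<le>K. if k + m = s then H k m else 0) = (\<Sum>m\<le>K. if m = s - k then H k m else 0)"
      by (intro sum.cong) auto
    moreover have "s - k \<le> K" using assms by simp
    ultimately show ?thesis using True by simp
  qed (auto intro!: sum.neutral)
  then have "(\<Sum>k\<le>K. \<Sum>m\<le>K. if k + m = s then H k m else 0)
      = (\<Sum>k\<le>K. if k \<le> s then H k (s - k) else 0)" by simp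
  also have "\<dots> = (\<Sum>k\<le>s. H k (s - k))"
    by (rule sum.mono_neutral_cong_right) (use assms in auto)
  finally show ?thesis .
qed

lemma skew_mult_in: "range f \<subseteq> S \<Longrightarrow> range g \<subseteq> S \<Longrightarrow> skew_mult D f g n \<in> S"
  unfolding skew_mult_def by (rule S_sum) (auto intro!: S_simps(6) Dn_closed simp: range_subsetD)

lemma skew_mult_assoc:
  assumes f: "range f \<subseteq> S" "\<And>i. i < a \<Longrightarrow> f i = 0"
    and g: "range g \<subseteq> S" "\<And>i. i < b \<Longrightarrow> g i = 0"
    and h: "range h \<subseteq> S" "\<And>i. i < c \<Longrightarrow> h i = 0"
  shows "skew_mult D (skew_mult D f g) h n = skew_mult D f (skew_mult D g h) n"
proof -
  have fS: "f i \<in> S" and gS: "g i \<in> S" and hS: "h i \<in> S" for i using f g h by auto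
  define I J L P Q K where "I = {a..n - b - c}" and "J = {b..n - a - c}" and "L = {c..n - a - b}"
    and "P = {a + b..n - c}" and "Q = {b + c..n - a}" and "K = nat (n - a - b - c)"
  note defs = I_def J_def L_def P_def Q_def K_def
  have fg0: "skew_mult D f g p = 0" if "p < a + b" for p
    using f(2) g(2) that by (rule skew_mult_below)
  have gh0: "skew_mult D g h p = 0" if "p < b + c" for p
    using g(2) h(2) that by (rule skew_mult_below)
  have fin: "finite I" "finite J" "finite L" "finite P" "finite Q" unfolding defs by auto
  define X where "X = (\<lambda>i j l. \<Sum>k\<le>K. \<Sum>m\<le>K. if i + j + l + 2 * int (k + m) = n then
    f i * (skew_coeff i k * (D ^^ k) (g j) * (skew_coeff (i + j + 2 * int k) m * (D ^^ m) (h l))) else 0)"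
  define Y where "Y = (\<lambda>i j l. \<Sum>t\<le>K. \<Sum>u\<le>K. if i + j + l + 2 * int (t + u) = n then
    f i * (skew_coeff i t * (skew_coeff j u * (D ^^ t) (g j * (D ^^ u) (h l)))) else 0)"
  have XY: "X i j l = Y i j l" if "i \<in> I" "j \<in> J" "l \<in> L" for i j l
  proof (cases "\<exists>s. i + j + l + 2 * int s = n")
    case True
    then obtain s where s: "i + j + l + 2 * int s = n" by blast
    then have "s \<le> K" using that unfolding defs by auto
    have e: "i + j + l + 2 * int (k + m) = n \<longleftrightarrow> k + m = s" for k m using s by auto
    show ?thesis unfolding X_def Y_def e double_sum_delta[OF \<open>s \<le> K\<close>]
      unfolding sum_distrib_left[symmetric] skew_assoc_core[OF gS hS] ..
  next
    case False
    then show ?thesis unfolding X_def Y_def by (simp del: of_nat_add)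
  qed
  have "skew_mult D (skew_mult D f g) h n = (\<Sum>p\<in>P. \<Sum>l\<in>L. \<Sum>m\<le>K. if p + l + 2 * int m = n
     then skew_mult D f g p * skew_coeff p m * (D ^^ m) (h l) else 0)"
    by (rule skew_mult_box[where a = "a + b" and b = c])
       (use fg0 h in \<open>auto simp: defs\<close>)
  also have "\<dots> = (\<Sum>p\<in>P. \<Sum>l\<in>L. \<Sum>m\<le>K. \<Sum>i\<in>I. \<Sum>j\<in>J. \<Sum>k\<le>K.
     if p = i + j + 2 * int k then (if p + l + 2 * int m = n
      then f i * skew_coeff i k * (D ^^ k) (g j) * skew_coeff p m * (D ^^ m) (h l) else 0) else 0)"
  proof (intro sum.cong refl, goal_cases)
    case (1 p l m)
    have "skew_mult D f g p = (\<Sum>i\<in>I. \<Sum>j\<in>J. \<Sum>k\<le>K.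
        if i + j + 2 * int k = p then f i * skew_coeff i k * (D ^^ k) (g j) else 0)"
      by (rule skew_mult_box[where a = a and b = b]) (use f g 1 in \<open>auto simp: defs\<close>)
    then show ?case
      by (cases "p + l + 2 * int m = n") (auto simp: sum_distrib_right intro!: sum.cong sum.neutral)
  qed
  also have "\<dots> = (\<Sum>(p, l, m, i, j, k)\<in>P \<times> L \<times> {..K} \<times> I \<times> J \<times> {..K}.
     if p = i + j + 2 * int k then (if p + l + 2 * int m = n
      then f i * skew_coeff i k * (D ^^ k) (g j) * skew_coeff p m * (D ^^ m) (h l) else 0) else 0)"
    by (simp add: sum.cartesian_product split_def)
  also have "\<dots> = (\<Sum>((i, j, l, k, m), p)\<in>(I \<times> J \<times> L \<times> {..K} \<times> {..K}) \<times> P.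
     if p = i + j + 2 * int k then (if p + l + 2 * int m = n
      then f i * skew_coeff i k * (D ^^ k) (g j) * skew_coeff p m * (D ^^ m) (h l) else 0) else 0)"
    by (rule sum.reindex_bij_witness[of _ "\<lambda>((i, j, l, k, m), p). (p, l, m, i, j, k)"
          "\<lambda>(p, l, m, i, j, k). ((i, j, l, k, m), p)"]) auto
  also have "\<dots> = (\<Sum>(i, j, l, k, m)\<in>I \<times> J \<times> L \<times> {..K} \<times> {..K}. \<Sum>p\<in>P.
     if p = i + j + 2 * int k then (if p + l + 2 * int m = n
      then f i * skew_coeff i k * (D ^^ k) (g j) * skew_coeff p m * (D ^^ m) (h l) else 0) else 0)"
    by (simp add: sum.cartesian_product split_def)
  also have "\<dots> = (\<Sum>(i, j, l, k, m)\<in>I \<times> J \<times> L \<times> {..K} \<times> {..K}.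
     if i + j + l + 2 * int (k + m) = n then
    f i * (skew_coeff i k * (D ^^ k) (g j) * (skew_coeff (i + j + 2 * int k) m * (D ^^ m) (h l))) else 0)"
  proof (intro sum.cong refl, clarsimp simp: fin, goal_cases)
    case (1 i j l k m)
    then show ?case by (auto simp: defs mult_ac algebra_simps)
  qed
  also have "\<dots> = (\<Sum>i\<in>I. \<Sum>j\<in>J. \<Sum>l\<in>L. X i j l)"
    unfolding X_def by (simp add: sum.cartesian_product split_def)
  finally have LHS: "skew_mult D (skew_mult D f g) h n = (\<Sum>i\<in>I. \<Sum>j\<in>J. \<Sum>l\<in>L. X i j l)" .
  have "skew_mult D f (skew_mult D g h) n = (\<Sum>i\<in>I. \<Sum>q\<in>Q. \<Sum>t\<le>K. if i + q + 2 * int t = n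
     then f i * skew_coeff i t * (D ^^ t) (skew_mult D g h q) else 0)"
    by (rule skew_mult_box[where a = a and b = "b + c"])
       (use f gh0 in \<open>auto simp: defs\<close>)
  also have "\<dots> = (\<Sum>i\<in>I. \<Sum>q\<in>Q. \<Sum>t\<le>K. \<Sum>j\<in>J. \<Sum>l\<in>L. \<Sum>u\<le>K.
     if q = j + l + 2 * int u then (if i + q + 2 * int t = n
      then f i * (skew_coeff i t * (skew_coeff j u * (D ^^ t) (g j * (D ^^ u) (h l)))) else 0) else 0)"
  proof (intro sum.cong refl, goal_cases)
    case (1 i q t)
    have "skew_mult D g h q = (\<Sum>j\<in>J. \<Sum>l\<in>L. \<Sum>u\<le>K.
        if j + l + 2 * int u = q then g j * skew_coeff j u * (D ^^ u) (h l) else 0)"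
      by (rule skew_mult_box[where a = b and b = c]) (use g h 1 in \<open>auto simp: defs\<close>)
    also have "(D ^^ t) \<dots> = (\<Sum>j\<in>J. \<Sum>l\<in>L. \<Sum>u\<le>K.
        (D ^^ t) (if j + l + 2 * int u = q then g j * skew_coeff j u * (D ^^ u) (h l) else 0))"
      by (simp add: Dn_sum S_sum gS hS)
    also have "\<dots> = (\<Sum>j\<in>J. \<Sum>l\<in>L. \<Sum>u\<le>K.
        if q = j + l + 2 * int u then skew_coeff j u * (D ^^ t) (g j * (D ^^ u) (h l)) else 0)"
      by (intro sum.cong refl) (auto simp: mult.left_commute[of "g _"] mult.assoc Dn_skew_coeff gS hS)
    finally show ?case
      by (cases "i + q + 2 * int t = n")
         (auto simp: sum_distrib_left mult.assoc intro!: sum.cong sum.neutral)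
  qed
  also have "\<dots> = (\<Sum>(i, q, t, j, l, u)\<in>I \<times> Q \<times> {..K} \<times> J \<times> L \<times> {..K}.
     if q = j + l + 2 * int u then (if i + q + 2 * int t = n
      then f i * (skew_coeff i t * (skew_coeff j u * (D ^^ t) (g j * (D ^^ u) (h l)))) else 0) else 0)"
    by (simp add: sum.cartesian_product split_def)
  also have "\<dots> = (\<Sum>((i, j, l, t, u), q)\<in>(I \<times> J \<times> L \<times> {..K} \<times> {..K}) \<times> Q.
     if q = j + l + 2 * int u then (if i + q + 2 * int t = n
      then f i * (skew_coeff i t * (skew_coeff j u * (D ^^ t) (g j * (D ^^ u) (h l)))) else 0) else 0)"
    by (rule sum.reindex_bij_witness[of _ "\<lambda>((i, j, l, t, u), q). (i, q, t, j, l, u)"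
          "\<lambda>(i, q, t, j, l, u). ((i, j, l, t, u), q)"]) auto
  also have "\<dots> = (\<Sum>(i, j, l, t, u)\<in>I \<times> J \<times> L \<times> {..K} \<times> {..K}. \<Sum>q\<in>Q.
     if q = j + l + 2 * int u then (if i + q + 2 * int t = n
      then f i * (skew_coeff i t * (skew_coeff j u * (D ^^ t) (g j * (D ^^ u) (h l)))) else 0) else 0)"
    by (simp add: sum.cartesian_product split_def)
  also have "\<dots> = (\<Sum>(i, j, l, t, u)\<in>I \<times> J \<times> L \<times> {..K} \<times> {..K}.
     if i + j + l + 2 * int (t + u) = n then
    f i * (skew_coeff i t * (skew_coeff j u * (D ^^ t) (g j * (D ^^ u) (h l)))) else 0)"
  proof (intro sum.cong refl, clarsimp simp: fin, goal_cases)
    case (1 i j l k m)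
    then show ?case by (auto simp: defs algebra_simps)
  qed
  also have "\<dots> = (\<Sum>i\<in>I. \<Sum>j\<in>J. \<Sum>l\<in>L. Y i j l)"
    unfolding Y_def by (simp add: sum.cartesian_product split_def)
  finally show ?thesis unfolding LHS by (simp add: XY)
qed

lemma skew_mult_const_left:
  assumes "\<And>j. j < b \<Longrightarrow> g j = 0"
  shows "skew_mult D (lconst a) g n = a * g n"
proof -
  have 0: "skew_coeff 0 k = (if k = 0 then 1 else 0 :: 'a)" for k by auto
  have "skew_mult D (lconst a) g n = (\<Sum>x\<in>{(0 :: int, n, 0 :: nat)}. a * g n)"
    unfolding skew_mult_def
  proof (rule sum.mono_neutral_cong)
    show "finite {(i, j, k). lconst a i \<noteq> 0 \<and> g j \<noteq> 0 \<and> i + j + 2 * int k = n}"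
      by (rule skew_mult_index_finite[where a = 0 and b = b]) (use assms in \<open>auto simp: lmonom_def\<close>)
  qed (auto simp: lmonom_def 0 simp del: skew_coeff_zero split: if_splits)
  then show ?thesis by simp
qed

lemma skew_mult_y_power_right:
  assumes "\<And>i. i < a \<Longrightarrow> f i = 0"
  shows "skew_mult D f (lmonom 1 m) n = f (n - m)"
proof -
  have 1: "(D ^^ k) 1 = (if k = 0 then 1 else 0)" for k
    by (cases k) (auto simp del: funpow.simps simp: funpow_Suc_right)
  have "skew_mult D f (lmonom 1 m) n = (\<Sum>x\<in>{(n - m, m, 0 :: nat)}. f (n - m))"
    unfolding skew_mult_def
  proof (rule sum.mono_neutral_cong)
    show "finite {(i, j, k). f i \<noteq> 0 \<and> lmonom (1::'a) m j \<noteq> 0 \<and> i + j + 2 * int k = n}"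
      by (rule skew_mult_index_finite[where b = m and a = a]) (use assms in \<open>auto simp: lmonom_def\<close>)
  qed (auto simp: lmonom_def 1 split: if_splits)
  then show ?thesis by simp
qed

lemma y_times_const:
  "skew_mult D (lmonom 1 1) (lconst f) n =
     (if n \<ge> 1 \<and> odd n then let k = nat ((n - 1) div 2) in skew_coeff 1 k * (D ^^ k) f else 0)"
proof (cases "n \<ge> 1 \<and> odd n \<and> f \<noteq> 0")
  case True
  define k where "k = nat ((n - 1) div 2)"
  have n: "n = 1 + 2 * int k" using True unfolding k_def by auto
  have "skew_mult D (lmonom 1 1) (lconst f) n = (\<Sum>x\<in>{(1 :: int, 0 :: int, k)}. skew_coeff 1 k * (D ^^ k) f)"
    unfolding skew_mult_def
  proof (rule sum.mono_neutral_cong)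
    show "finite {(i, j, k). lmonom (1::'a) 1 i \<noteq> 0 \<and> lconst f j \<noteq> 0 \<and> i + j + 2 * int k = n}"
      by (rule skew_mult_index_finite[where a = 1 and b = 0]) (auto simp: lmonom_def)
  qed (use True n in \<open>auto simp: lmonom_def split: if_splits\<close>)
  then show ?thesis using True by (simp add: k_def Let_def)
next
  case False
  have "skew_mult D (lmonom 1 1) (lconst f) n = 0"
    unfolding skew_mult_def lmonom_def
    by (rule sum.neutral) (use False in \<open>auto split: if_splits\<close>)
  then show ?thesis using False by (auto simp: Let_def)
qed

lemma skew_mult_add_left:
  assumes "\<And>i. i < a \<Longrightarrow> f i = 0" "\<And>i. i < a \<Longrightarrow> f' i = 0" "\<And>i. i < b \<Longrightarrow> g i = 0"
  shows "skew_mult D (\<lambda>i. f i + f' i) g n = skew_mult D f g n + skew_mult D f' g n"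
proof -
  note box = skew_mult_box[where a = a and b = b and I = "{a..n - b}" and J = "{b..n - a}"
      and K = "nat (n - a - b)" and n = n, OF _ _ finite_atLeastAtMost_int finite_atLeastAtMost_int
      order_refl order_refl order_refl]
  show ?thesis
    by (subst (1 2 3) box) (auto simp: assms sum.distrib[symmetric] algebra_simps intro!: sum.cong)
qed

lemma skew_mult_add_right:
  assumes "\<And>i. i < a \<Longrightarrow> f i = 0" "\<And>i. i < b \<Longrightarrow> g i = 0" "\<And>i. i < b \<Longrightarrow> g' i = 0"
    and "range g \<subseteq> S" "range g' \<subseteq> S"
  shows "skew_mult D f (\<lambda>i. g i + g' i) n = skew_mult D f g n + skew_mult D f g' n"
proof -
  note box = skew_mult_box[where a = a and b = b and I = "{a..n - b}" and J = "{b..n - a}"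
      and K = "nat (n - a - b)" and n = n, OF _ _ finite_atLeastAtMost_int finite_atLeastAtMost_int
      order_refl order_refl order_refl]
  have "g i \<in> S" "g' i \<in> S" for i using assms by auto
  then show ?thesis
    by (subst (1 2 3) box) (auto simp: assms Dn_add sum.distrib[symmetric] algebra_simps intro!: sum.cong)
qed

lemma skew_carrierE:
  assumes "f \<in> carrier (skew_laurent S D)"
  obtains a where "range f \<subseteq> S" "\<And>i. i < a \<Longrightarrow> f i = 0"
  using assms unfolding skew_laurent_def by auto

lemma skew_carrier_common:
  assumes "f \<in> carrier (skew_laurent S D)" "g \<in> carrier (skew_laurent S D)"
  obtains m where "\<And>i. i < m \<Longrightarrow> f i = 0" "\<And>i. i < m \<Longrightarrow> g i = 0"
proof -
  obtain a where a: "\<And>i. i < a \<Longrightarrow> f i = 0" using assms(1) by (rule skew_carrierE) blast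
  obtain b where b: "\<And>i. i < b \<Longrightarrow> g i = 0" using assms(2) by (rule skew_carrierE) blast
  show thesis by (rule that[of "min a b"]) (simp_all add: a b)
qed

lemma skew_carrierI:
  "\<lbrakk>\<And>i. f i \<in> S; \<And>i. i < a \<Longrightarrow> f i = 0\<rbrakk> \<Longrightarrow> f \<in> carrier (skew_laurent S D)"
  unfolding skew_laurent_def by auto

lemma skew_laurent_sel:
  "f \<otimes>\<^bsub>skew_laurent S D\<^esub> g = skew_mult D f g" "\<one>\<^bsub>skew_laurent S D\<^esub> = lconst 1"
  "f \<oplus>\<^bsub>skew_laurent S D\<^esub> g = (\<lambda>n. f n + g n)" "\<zero>\<^bsub>skew_laurent S D\<^esub> = (\<lambda>_. 0)"
  by (simp_all add: skew_laurent_def lmonom_def)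

theorem skew_laurent_ring: "ring (skew_laurent S D)"
proof -
  let ?C = "skew_laurent S D"
  have add: "(\<lambda>n. f n + g n) \<in> carrier ?C" if fg: "f \<in> carrier ?C" "g \<in> carrier ?C" for f g
  proof -
    obtain m where m: "\<And>i. i < m \<Longrightarrow> f i = 0" "\<And>i. i < m \<Longrightarrow> g i = 0"
      using skew_carrier_common[OF fg] by blast
    have "f i \<in> S" "g i \<in> S" for i using fg by (auto elim!: skew_carrierE)
    then show ?thesis using m by (intro skew_carrierI[where a = m]) auto
  qed
  have mult: "skew_mult D f g \<in> carrier ?C" if fg: "f \<in> carrier ?C" "g \<in> carrier ?C" for f g
  proof -
    obtain a where f: "range f \<subseteq> S" "\<And>i. i < a \<Longrightarrow> f i = 0" using fg(1) by (rule skew_carrierE) blast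
    obtain b where g: "range g \<subseteq> S" "\<And>i. i < b \<Longrightarrow> g i = 0" using fg(2) by (rule skew_carrierE) blast
    show ?thesis
    proof (rule skew_carrierI[where a = "a + b"])
      show "skew_mult D f g n \<in> S" for n using f(1) g(1) by (rule skew_mult_in)
      show "skew_mult D f g n = 0" if "n < a + b" for n using f(2) g(2) that by (rule skew_mult_below)
    qed
  qed
  have one: "lconst 1 \<in> carrier ?C" and zero: "(\<lambda>_. 0) \<in> carrier ?C"
    by (auto intro!: skew_carrierI[where a = 0] simp: lmonom_def)
  have ag: "abelian_group ?C"
  proof (rule abelian_groupI, unfold skew_laurent_sel)
    fix f assume "f \<in> carrier ?C"
    then obtain a where a: "range f \<subseteq> S" "\<And>i. i < a \<Longrightarrow> f i = 0" by (rule skew_carrierE) blast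
    show "\<exists>g\<in>carrier ?C. (\<lambda>n. g n + f n) = (\<lambda>_. 0)"
      by (rule bexI[where x = "\<lambda>n. - f n"]) (use a in \<open>auto intro!: skew_carrierI[where a = a]\<close>)
  qed (auto simp: add zero add_ac)
  show ?thesis
  proof (rule ring.intro[OF ag], rule monoidI, unfold skew_laurent_sel)
    fix f g h assume fgh: "f \<in> carrier ?C" "g \<in> carrier ?C" "h \<in> carrier ?C"
    obtain a where f: "range f \<subseteq> S" "\<And>i. i < a \<Longrightarrow> f i = 0" using fgh(1) by (rule skew_carrierE) blast
    obtain b where g: "range g \<subseteq> S" "\<And>i. i < b \<Longrightarrow> g i = 0" using fgh(2) by (rule skew_carrierE) blast
    obtain c where h: "range h \<subseteq> S" "\<And>i. i < c \<Longrightarrow> h i = 0" using fgh(3) by (rule skew_carrierE) blast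
    show "skew_mult D (skew_mult D f g) h = skew_mult D f (skew_mult D g h)"
      using f g h by (intro ext skew_mult_assoc)
  next
    show "ring_axioms ?C"
    proof (rule ring_axioms.intro, unfold skew_laurent_sel)
      fix f g h assume fgh: "f \<in> carrier ?C" "g \<in> carrier ?C" "h \<in> carrier ?C"
      obtain c where c: "range h \<subseteq> S" "\<And>i. i < c \<Longrightarrow> h i = 0" using fgh(3) by (rule skew_carrierE) blast
      from fgh have S: "range f \<subseteq> S" "range g \<subseteq> S" by (auto elim!: skew_carrierE)
      obtain m where m: "\<And>i. i < m \<Longrightarrow> f i = 0" "\<And>i. i < m \<Longrightarrow> g i = 0"
        using skew_carrier_common[OF fgh(1,2)] by blast
      show "skew_mult D (\<lambda>n. f n + g n) h = (\<lambda>n. skew_mult D f h n + skew_mult D g h n)"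
        by (rule ext, rule skew_mult_add_left[where a = m and b = c]) (use m c in auto)
      show "skew_mult D h (\<lambda>n. f n + g n) = (\<lambda>n. skew_mult D h f n + skew_mult D h g n)"
        by (rule ext, rule skew_mult_add_right[where b = m and a = c]) (use m c S in auto)
    qed
    show "lconst 1 \<in> carrier ?C" by (rule one)
  next
    fix f assume "f \<in> carrier ?C"
    then obtain a where a: "\<And>i. i < a \<Longrightarrow> f i = 0" by (rule skew_carrierE) blast
    show "skew_mult D (lconst 1) f = f" "skew_mult D f (lconst 1) = f"
      using skew_mult_const_left[of a f] skew_mult_y_power_right[of a f 0] a by auto
  qed (rule mult)
qed

end

end

theory Submission
  imports Defs "HOL-Library.Function_Algebras"
begin

text \<open>
  Write $C = R((y;\<delta>))_2$ and let $\<Phi>$ send $\sum f_i z^i$ to $\sum f_i v^i$.  The theorem says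
  that $\<Phi>$ maps $R^\<Gamma>((z;\<Delta>))_2$ isomorphically onto $C^\<Gamma>$.  Everything rests on
  the fact that the rule defining $C$ takes its simplest form for the exponent $-2$:
  $y^{-2} a = a y^{-2} - 2 \<delta>(a)$.  Hence $w = e^2 y^{-2} + h$ satisfies
  $w a = a w - 2 \<Delta>(a)$, and $2\<Delta>(a) = a w - w a$ is invariant whenever $a$ is.  This is why
  \<Delta> restricts to $R^\<Gamma>$.

  First forget the group.  Since $v = e^{-1} y + \cdots$ has an invertible leading coefficient, so
  has every power $v^i$, and solving for one coefficient after the other shows that $\<Phi>$ is a
  bijection from $R((z;\<Delta>))_2$ to $C$.  It is multiplicative as soon as
  $\<Phi>(z g) = v \<Phi>(g)$ for all $g$.  The relation for $w = v^{-2}$ gives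
  $\<Phi>(z^{-2} g) = v^{-2} \<Phi>(g)$, hence the same for $z^2$.  The passage from $z^2$ to its square
  root $z$ is the heart of the proof: the defect $u(g) = v \<Phi>(g) - \<Phi>(z g)$ satisfies
  $v u(g) + u(z g) = 0$ and $u(g z) = u(g) v$.  As $z g$ and $g z$ have the same leading term, the
  lowest coefficient of $u(g)$ is killed by $2 e^{-1}$; so $u$ raises the valuation by arbitrarily
  large amounts and vanishes (lemma \<open>left_multiplicative_1\<close>).

  Now let \<theta> be the automorphism given by an element of \<Gamma>.  It preserves the valuation: an
  element $1 + f$ with $f$ of positive valuation is a square of an element of the same shape, so the
  valuation of its image is divisible by every power of 2 and is 0; from this one gets
  $\<theta>(y) = a y + \cdots$ with $a$ invertible (lemma \<open>image_y\<close>).  The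
  cocycle hypothesis on $e$ says exactly that $\<theta>(v)$ starts with $e^{-1} y$ again, and
  $\<theta>(v)^2 = \<theta>(w^{-1}) = w^{-1}$, so $\<theta>(v) = v$ by uniqueness of square roots.
  Therefore \<theta> acts on $\sum f_i v^i$ by acting on the coefficients, and since $\<Phi>$ is
  injective, $\<Phi>(f)$ is invariant if and only if all coefficients of $f$ are.
\<close>

section \<open>Laurent series and their filtration\<close>

definition vanishes_below :: "int \<Rightarrow> (int \<Rightarrow> 'a::zero) \<Rightarrow> bool" where
  "vanishes_below m f \<longleftrightarrow> (\<forall>i<m. f i = 0)"

definition laurent_series :: "(int \<Rightarrow> 'a::zero) set" where
  "laurent_series = {f. \<exists>m. vanishes_below m f}"

lemma vanishes_belowD: "vanishes_below m f \<Longrightarrow> i < m \<Longrightarrow> f i = 0"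
  by (simp add: vanishes_below_def)

lemma vanishes_below_mono: "vanishes_below m f \<Longrightarrow> k \<le> m \<Longrightarrow> vanishes_below k f"
  by (simp add: vanishes_below_def)

lemma vanishes_below_Suc: "vanishes_below m f \<Longrightarrow> f m = 0 \<Longrightarrow> vanishes_below (m + 1) f"
  by (metis vanishes_below_def zless_add1_eq)

lemma vanishes_below_add:
  "vanishes_below m f \<Longrightarrow> vanishes_below m g \<Longrightarrow> vanishes_below m (f + (g :: int \<Rightarrow> 'a::monoid_add))"
  by (simp add: vanishes_below_def)

lemma vanishes_below_diff:
  "vanishes_below m f \<Longrightarrow> vanishes_below m g \<Longrightarrow> vanishes_below m (f - (g :: int \<Rightarrow> 'a::group_add))"
  by (simp add: vanishes_below_def)

lemma vanishes_below_lmonom [simp]: "m \<le> k \<Longrightarrow> vanishes_below m (lmonom a k)"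
  by (simp add: vanishes_below_def lmonom_def)

lemma vanishes_below_0 [simp]: "vanishes_below m (0 :: int \<Rightarrow> 'a::zero)"
  by (simp add: vanishes_below_def)

lemma laurentI [intro]: "vanishes_below m f \<Longrightarrow> f \<in> laurent_series"
  by (auto simp: laurent_series_def)

lemma laurentE: "f \<in> laurent_series \<Longrightarrow> (\<And>m. vanishes_below m f \<Longrightarrow> P) \<Longrightarrow> P"
  by (auto simp: laurent_series_def)

lemma laurent_lmonom [simp]: "lmonom a m \<in> laurent_series"
  by (rule laurentI[of m]) simp

lemma laurent_0 [simp]: "0 \<in> laurent_series"
  by (rule laurentI[of 0]) simp

lemma laurent_common_bound:
  assumes "f \<in> laurent_series" "g \<in> laurent_series"
  obtains m where "vanishes_below m f" "vanishes_below m g"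
proof -
  obtain a b where "vanishes_below a f" "vanishes_below b g" using assms by (auto elim!: laurentE)
  then show thesis using that[of "min a b"] vanishes_below_mono[of a f "min a b"] vanishes_below_mono[of b g "min a b"]
    by simp
qed

lemma laurent_add [simp]:
  "f \<in> laurent_series \<Longrightarrow> g \<in> laurent_series \<Longrightarrow> f + (g :: int \<Rightarrow> 'a::monoid_add) \<in> laurent_series"
  by (metis laurent_common_bound laurentI vanishes_below_add)

lemma laurent_diff [simp]:
  "f \<in> laurent_series \<Longrightarrow> g \<in> laurent_series \<Longrightarrow> f - (g :: int \<Rightarrow> 'a::group_add) \<in> laurent_series"
  by (metis laurent_common_bound laurentI vanishes_below_diff)

lemma starts_with_iff: "starts_with f a m \<longleftrightarrow> f m = a \<and> vanishes_below m f"
  by (simp add: starts_with_def vanishes_below_def)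

lemma starts_with_laurent: "starts_with f a m \<Longrightarrow> f \<in> laurent_series"
  by (auto simp: starts_with_iff)

lemma starts_with_lmonom [simp]: "starts_with (lmonom a m) a m"
  by (simp add: starts_with_def lmonom_def)

lemma starts_with_unique:
  assumes "starts_with f a m" "starts_with f b k" "a \<noteq> 0" "b \<noteq> 0"
  shows "a = b" "m = k"
proof -
  show "m = k" using assms unfolding starts_with_def by (metis linorder_neqE)
  then show "a = b" using assms by (simp add: starts_with_def)
qed

lemma starts_with_exists:
  assumes "f \<in> laurent_series" "f \<noteq> 0"
  obtains a m where "a \<noteq> 0" "starts_with f a m"
proof -
  obtain m where m: "vanishes_below m f" using assms(1) by (rule laurentE)
  obtain i where i: "f i \<noteq> 0" using assms(2) by (auto simp: fun_eq_iff)
  then have "m \<le> i" using m by (force simp: vanishes_below_def)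
  define k where "k = (LEAST k. f (m + int k) \<noteq> 0)"
  have "f (m + int (nat (i - m))) \<noteq> 0" using i \<open>m \<le> i\<close> by simp
  then have 1: "f (m + int k) \<noteq> 0" unfolding k_def by (rule LeastI)
  have "f j = 0" if "j < m + int k" for j
  proof (cases "j < m")
    case True
    then show ?thesis using m by (simp add: vanishes_below_def)
  next
    case False
    then have "nat (j - m) < k" using that by simp
    then have "f (m + int (nat (j - m))) = 0" unfolding k_def by (rule not_less_Least[THEN notnotD])
    then show ?thesis using False by simp
  qed
  then show thesis using 1 that[of "f (m + int k)" "m + int k"] by (simp add: starts_with_def)
qed

section \<open>Additive maps compatible with the filtration\<close>

text \<open>
  These are the additive maps that are continuous, uniformly, for the topology of the valuation.
  The shift \<open>c\<close> is recorded because the argument for \<open>left_multiplicative_1\<close> improves it step by step.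
\<close>
definition filtered_additive :: "int \<Rightarrow> ((int \<Rightarrow> 'a) \<Rightarrow> int \<Rightarrow> 'a::ab_group_add) \<Rightarrow> bool" where
  "filtered_additive c L \<longleftrightarrow>
     (\<forall>f\<in>laurent_series. \<forall>g\<in>laurent_series. L (f + g) = L f + L g) \<and>
     (\<forall>m f. vanishes_below m f \<longrightarrow> vanishes_below (m + c) (L f))"

lemma filtered_additiveI:
  "\<lbrakk>\<And>f g. f \<in> laurent_series \<Longrightarrow> g \<in> laurent_series \<Longrightarrow> L (f + g) = L f + L g;
    \<And>m f. vanishes_below m f \<Longrightarrow> vanishes_below (m + c) (L f)\<rbrakk> \<Longrightarrow> filtered_additive c L"
  by (simp add: filtered_additive_def)

lemma filtered_additive_add:
  "filtered_additive c L \<Longrightarrow> f \<in> laurent_series \<Longrightarrow> g \<in> laurent_series \<Longrightarrow> L (f + g) = L f + L g"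
  by (simp add: filtered_additive_def)

lemma filtered_additive_bound:
  "filtered_additive c L \<Longrightarrow> vanishes_below m f \<Longrightarrow> vanishes_below (m + c) (L f)"
  by (simp add: filtered_additive_def)

lemma filtered_additive_closed:
  "filtered_additive c L \<Longrightarrow> f \<in> laurent_series \<Longrightarrow> L f \<in> laurent_series"
  by (meson filtered_additive_bound laurentE laurentI)

lemma filtered_additive_minus:
  assumes "filtered_additive c L" "f \<in> laurent_series" "g \<in> laurent_series"
  shows "L (f - g) = L f - L g"
  using filtered_additive_add[OF assms(1), of "f - g" g] assms by simp

lemma filtered_additive_mono: "filtered_additive c L \<Longrightarrow> c' \<le> c \<Longrightarrow> filtered_additive c' L"
  unfolding filtered_additive_def by (meson add_left_mono vanishes_below_mono)

lemma filtered_additive_comp: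
  assumes "filtered_additive c L" "filtered_additive c' L'"
  shows "filtered_additive (c' + c) (\<lambda>f. L (L' f))"
proof (rule filtered_additiveI)
  fix m and f :: "int \<Rightarrow> 'a" assume "vanishes_below m f"
  then have "vanishes_below (m + c' + c) (L (L' f))" using assms by (intro filtered_additive_bound)
  then show "vanishes_below (m + (c' + c)) (L (L' f))" by (simp add: add.assoc)
qed (simp only: filtered_additive_add[OF assms(2)] filtered_additive_add[OF assms(1)]
       filtered_additive_closed[OF assms(2)])

lemma filtered_additive_diff:
  assumes "filtered_additive c L" "filtered_additive c L'"
  shows "filtered_additive c (\<lambda>f. L f - L' f)"
proof (rule filtered_additiveI)
  fix f g :: "int \<Rightarrow> 'a" assume "f \<in> laurent_series" "g \<in> laurent_series"
  then show "L (f + g) - L' (f + g) = (L f - L' f) + (L g - L' g)"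
    using filtered_additive_add[OF assms(1), of f g] filtered_additive_add[OF assms(2), of f g] by simp
qed (intro vanishes_below_diff filtered_additive_bound[OF assms(1)] filtered_additive_bound[OF assms(2)])

text \<open>
  Splitting off leading monomials replaces \<open>f\<close> by tails of arbitrarily high valuation without
  changing the difference of the two maps, so that this difference has no lowest term.  This reduces
  identities between infinite series to identities between monomials.
\<close>
lemma filtered_additive_ext:
  assumes L: "filtered_additive c L" and L': "filtered_additive c' L'"
    and monomials: "\<And>a j. L (lmonom a j) = L' (lmonom a j)"
    and f: "f \<in> laurent_series"
  shows "L f = L' f"
proof -
  define c0 where "c0 = min c c'"
  define M where "M = (\<lambda>f. L f - L' f)"
  have M: "filtered_additive c0 M" unfolding M_def
    by (intro filtered_additive_diff filtered_additive_mono[OF L] filtered_additive_mono[OF L'])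
       (auto simp: c0_def)
  obtain m where m: "vanishes_below m f" using f by (rule laurentE)
  have tail: "\<exists>g. vanishes_below (m + int k) g \<and> M f = M g" for k
  proof (induction k)
    case 0
    then show ?case using m by auto
  next
    case (Suc k)
    then obtain g where g: "vanishes_below (m + int k) g" "M f = M g" by auto
    define t where "t = lmonom (g (m + int k)) (m + int k)"
    have "vanishes_below (m + int k + 1) (g - t)"
      by (rule vanishes_below_Suc, rule vanishes_below_diff)
         (use g in \<open>simp_all add: t_def, simp add: lmonom_def\<close>)
    moreover have "M g = M (g - t)"
      using filtered_additive_minus[OF M, OF laurentI[OF g(1)], of t] monomials
      by (simp add: t_def M_def[THEN fun_cong, of "lmonom _ _"])
    ultimately show ?case using g by (auto simp: algebra_simps)
  qed
  have "M f n = 0" for n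
  proof -
    obtain g where g: "vanishes_below (m + int (nat (n - m - c0 + 1))) g" "M f = M g" using tail by blast
    have "M g n = 0" by (rule vanishes_belowD[OF filtered_additive_bound[OF M g(1)]]) simp
    then show ?thesis using g by simp
  qed
  then show ?thesis by (auto simp: M_def fun_eq_iff)
qed

section \<open>Solving equations coefficient by coefficient\<close>

text \<open>
  An abstract form of Hensel's lemma: changing the coefficient of \<open>x\<close> at \<open>n\<close> changes \<open>F x\<close> at \<open>n + s\<close>
  by a unit multiple and nothing below, so the coefficients of a solution are determined, and can
  be found, one after the other.  It yields inverses, square roots, and the bijectivity of the
  substitution of \<open>v\<close>.
\<close>
lemma successive_approximation:
  fixes F :: "(int \<Rightarrow> 'a::comm_ring_1) \<Rightarrow> int \<Rightarrow> 'a"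
  assumes unit: "\<And>n. n \<ge> p \<Longrightarrow> u n dvd 1"
    and step: "\<And>x x' n. \<lbrakk>n \<ge> p; vanishes_below p (x - x0); vanishes_below n (x' - x)\<rbrakk> \<Longrightarrow>
      vanishes_below (n + s) (F x' - F x) \<and> (F x' - F x) (n + s) = u n * (x' - x) n"
    and start: "vanishes_below (p + s) (g - F x0)"
  shows "\<exists>!x. vanishes_below p (x - x0) \<and> F x = g"
proof (rule ex_ex1I)
  define r where "r = (\<lambda>n. SOME b. u n * b = 1)"
  have r: "u n * r n = 1" if "n \<ge> p" for n
    using unit[OF that] unfolding r_def by (intro someI_ex[of "\<lambda>b. u n * b = 1"]) (auto simp: dvd_def)
  define X where "X = rec_nat x0 (\<lambda>k x. x +
     lmonom (r (p + int k) * (g - F x) (p + int k + s)) (p + int k))"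
  have X0: "X 0 = x0"
    and XS: "X (Suc k) = X k + lmonom (r (p + int k) * (g - F (X k)) (p + int k + s)) (p + int k)" for k
    by (simp_all add: X_def)
  have Xx0: "vanishes_below p (X k - x0)" for k
    by (induction k) (auto simp: X0 XS vanishes_below_def lmonom_def)
  have Fg: "vanishes_below (p + int k + s) (g - F (X k))" for k
  proof (induction k)
    case 0
    then show ?case using start by (simp only: X0 of_nat_0 add_0_right)
  next
    case (Suc k)
    let ?n = "p + int k"
    have "vanishes_below (?n + s) (F (X (Suc k)) - F (X k)) \<and>
        (F (X (Suc k)) - F (X k)) (?n + s) = u ?n * (X (Suc k) - X k) ?n"
      by (rule step) (use Xx0 in \<open>auto simp: XS\<close>)
    moreover have "u ?n * (X (Suc k) - X k) ?n = (g - F (X k)) (?n + s)"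
      using r[of ?n] by (simp add: XS lmonom_def mult.assoc[symmetric])
    ultimately have D: "vanishes_below (?n + s) (F (X (Suc k)) - F (X k))"
      "(F (X (Suc k)) - F (X k)) (?n + s) = (g - F (X k)) (?n + s)" by auto
    have "vanishes_below (?n + s + 1) ((g - F (X k)) - (F (X (Suc k)) - F (X k)))"
      by (rule vanishes_below_Suc[OF vanishes_below_diff[OF Suc D(1)]]) (use D(2) in simp)
    moreover have "(g - F (X k)) - (F (X (Suc k)) - F (X k)) = g - F (X (Suc k))"
      by (rule ext) simp
    moreover have "?n + s + 1 = p + int (Suc k) + s" by simp
    ultimately show ?case by (simp only:)
  qed
  have stable: "X (k + j) i = X k i" if "i < p + int k" for i k j
    using that by (induction j) (auto simp: XS lmonom_def)
  \<comment> \<open>The coefficient at i no longer changes after step i - p + 1.\<close>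
  define x where "x = (\<lambda>i. if i < p then x0 i else X (nat (i - p) + 1) i)"
  have xX: "vanishes_below (p + int k) (x - X k)" for k
    unfolding vanishes_below_def
  proof (intro allI impI)
    fix i assume i: "i < p + int k"
    show "(x - X k) i = 0"
    proof (cases "i < p")
      case True
      then show ?thesis using Xx0[of k] by (simp add: vanishes_below_def x_def)
    next
      case False
      then have "nat (i - p) + 1 + (k - (nat (i - p) + 1)) = k" using i by simp
      then show ?thesis using stable[of i "nat (i - p) + 1" "k - (nat (i - p) + 1)"] False
        by (simp add: x_def)
    qed
  qed
  have "F x = g"
  proof
    fix n
    define k where "k = nat (n - s - p + 1)"
    have n: "n < p + int k + s" by (simp add: k_def)
    have "vanishes_below (p + int k + s) (F x - F (X k))"
      using step[of "p + int k" "X k" x] Xx0 xX by simp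
    then show "F x n = g n" using Fg[of k] n by (simp add: vanishes_below_def)
  qed
  moreover have "vanishes_below p (x - x0)" by (simp add: vanishes_below_def x_def)
  ultimately show "\<exists>x. vanishes_below p (x - x0) \<and> F x = g" by blast
next
  fix x y assume x: "vanishes_below p (x - x0) \<and> F x = g" and y: "vanishes_below p (y - x0) \<and> F y = g"
  define e where "e = y - x"
  have *: "vanishes_below (p + int k) e" for k
  proof (induction k)
    case 0
    have "(y - x0) - (x - x0) = e" by (simp add: e_def)
    then show ?case using vanishes_below_diff[of p "y - x0" "x - x0"] x y by simp
  next
    case (Suc k)
    have "u (p + int k) * e (p + int k) = 0"
      using step[of "p + int k" x y] x y Suc by (simp add: e_def[symmetric] del: minus_apply)
    moreover obtain r where "u (p + int k) * r = 1" using unit[of "p + int k"] by (auto simp: dvd_def)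
    ultimately have "e (p + int k) = 0" by (metis mult.assoc mult.commute mult_1 mult_zero_right)
    then show ?case using vanishes_below_Suc[OF Suc] by (simp add: algebra_simps)
  qed
  show "x = y"
  proof
    fix n
    have "n < p + int (nat (n - p + 1))" by simp
    then show "x n = y n" using *[of "nat (n - p + 1)"] by (simp add: vanishes_below_def e_def)
  qed
qed

section \<open>The ring of skew Laurent series\<close>

abbreviation skew_prod (\<open>(_ \<star>\<^bsub>_\<^esub>/ _)\<close> [70, 0, 71] 70) where
  "f \<star>\<^bsub>D\<^esub> g \<equiv> skew_mult D f g"

lemma unit_inv_eqI: "a * b = 1 \<Longrightarrow> unit_inv a = (b :: 'a::comm_ring_1)"
  unfolding unit_inv_def by (rule the_equality) (assumption, metis mult.assoc mult.commute mult_1)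

lemma unit_inv_right: "a dvd 1 \<Longrightarrow> a * unit_inv a = (1 :: 'a::comm_ring_1)"
  by (metis dvd_def unit_inv_eqI)

lemma unit_inv_left: "a dvd 1 \<Longrightarrow> unit_inv a * a = (1 :: 'a::comm_ring_1)"
  by (simp add: unit_inv_right mult.commute)

lemma unit_inv_unit: "a dvd 1 \<Longrightarrow> unit_inv a dvd (1 :: 'a::comm_ring_1)"
  by (metis dvd_def unit_inv_left)

text \<open>
  The case of coefficients in the whole ambient ring $R$.  Series over the ring of invariants are
  treated as a subset of these.
\<close>
locale skew_full = skew_base UNIV D for D :: "'a::{idom, ring_char_0} \<Rightarrow> 'a"
begin

abbreviation "C \<equiv> skew_laurent UNIV D"

lemma carrier_eq: "carrier C = laurent_series"
  by (auto simp: skew_laurent_def laurent_series_def vanishes_below_def)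

lemma C_sel: "f \<otimes>\<^bsub>C\<^esub> g = f \<star>\<^bsub>D\<^esub> g" "\<one>\<^bsub>C\<^esub> = lconst 1" "f \<oplus>\<^bsub>C\<^esub> g = f + g" "\<zero>\<^bsub>C\<^esub> = 0"
  by (simp_all add: skew_laurent_sel plus_fun_def zero_fun_def)

sublocale ring C
  by (rule skew_laurent_ring)

lemma mult_bound: "vanishes_below a f \<Longrightarrow> vanishes_below b g \<Longrightarrow> vanishes_below (a + b) (f \<star>\<^bsub>D\<^esub> g)"
  using skew_mult_below[of a f b g] by (simp add: vanishes_below_def)

lemma mult_lead:
  assumes "vanishes_below a f" "vanishes_below b g"
  shows "(f \<star>\<^bsub>D\<^esub> g) (a + b) = f a * g b"
proof -
  have "(f \<star>\<^bsub>D\<^esub> g) (a + b) = (\<Sum>i\<in>{a}. \<Sum>j\<in>{b}. \<Sum>k\<le>0.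
    if i + j + 2 * int k = a + b then f i * skew_coeff i k * (D ^^ k) (g j) else 0)"
    by (rule skew_mult_box[where a = a and b = b])
       (use assms in \<open>auto simp: vanishes_below_def\<close>)
  then show ?thesis by simp
qed

lemma starts_with_mult:
  "starts_with f a m \<Longrightarrow> starts_with g b k \<Longrightarrow> starts_with (f \<star>\<^bsub>D\<^esub> g) (a * b) (m + k)"
  by (auto simp: starts_with_iff mult_bound mult_lead)

lemma mult_laurent [simp]: "f \<in> laurent_series \<Longrightarrow> g \<in> laurent_series \<Longrightarrow> f \<star>\<^bsub>D\<^esub> g \<in> laurent_series"
  using m_closed[of f g] by (simp add: carrier_eq C_sel)

lemma mult_assoc:
  "\<lbrakk>f \<in> laurent_series; g \<in> laurent_series; h \<in> laurent_series\<rbrakk> \<Longrightarrow>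
    (f \<star>\<^bsub>D\<^esub> g) \<star>\<^bsub>D\<^esub> h = f \<star>\<^bsub>D\<^esub> (g \<star>\<^bsub>D\<^esub> h)"
  using m_assoc[of f g h] by (simp add: carrier_eq C_sel)

lemma mult_one [simp]:
  "f \<in> laurent_series \<Longrightarrow> lconst 1 \<star>\<^bsub>D\<^esub> f = f" "f \<in> laurent_series \<Longrightarrow> f \<star>\<^bsub>D\<^esub> lconst 1 = f"
  using l_one[of f] r_one[of f] by (simp_all add: carrier_eq C_sel)

lemma filtered_additive_mult_left: "vanishes_below a f \<Longrightarrow> filtered_additive a (skew_mult D f)"
  using r_distr[of _ _ f] mult_bound[of a f]
  by (intro filtered_additiveI) (auto simp: carrier_eq C_sel add.commute)

lemma filtered_additive_mult_right: "vanishes_below a g \<Longrightarrow> filtered_additive a (\<lambda>f. f \<star>\<^bsub>D\<^esub> g)"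
  using l_distr[of _ _ g] mult_bound[of _ _ a g]
  by (intro filtered_additiveI) (auto simp: carrier_eq C_sel)

lemma mult_diff_left:
  "\<lbrakk>f \<in> laurent_series; g \<in> laurent_series; h \<in> laurent_series\<rbrakk> \<Longrightarrow>
    (f - g) \<star>\<^bsub>D\<^esub> h = f \<star>\<^bsub>D\<^esub> h - g \<star>\<^bsub>D\<^esub> h"
  by (metis filtered_additive_minus filtered_additive_mult_right laurentE)

lemma mult_diff_right:
  "\<lbrakk>f \<in> laurent_series; g \<in> laurent_series; h \<in> laurent_series\<rbrakk> \<Longrightarrow>
    h \<star>\<^bsub>D\<^esub> (f - g) = h \<star>\<^bsub>D\<^esub> f - h \<star>\<^bsub>D\<^esub> g"
  by (metis filtered_additive_minus filtered_additive_mult_left laurentE)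

lemma mult_const_left: "g \<in> laurent_series \<Longrightarrow> lconst a \<star>\<^bsub>D\<^esub> g = (\<lambda>n. a * g n)"
  by (rule ext) (auto simp: laurent_series_def vanishes_below_def intro: skew_mult_const_left)

lemma mult_y_power_right: "f \<in> laurent_series \<Longrightarrow> f \<star>\<^bsub>D\<^esub> lmonom 1 m = (\<lambda>n. f (n - m))"
  by (rule ext) (auto simp: laurent_series_def vanishes_below_def intro: skew_mult_y_power_right)

lemma const_mult_monom [simp]: "lconst a \<star>\<^bsub>D\<^esub> lmonom b m = lmonom (a * b) m"
  by (rule ext) (auto simp: mult_const_left, auto simp: lmonom_def)

lemma monom_mult_y_power [simp]: "lmonom a k \<star>\<^bsub>D\<^esub> lmonom 1 m = lmonom a (k + m)"
  by (rule ext) (auto simp: mult_y_power_right, auto simp: lmonom_def)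

text \<open>
  The numbers $c(-2,k)$ vanish for $k \ge 2$, as their product formula contains the factor $-2+2$.
  So for the exponent $-2$ the infinite commutation rule stops after two terms.
\<close>
lemma y_inv_square_commutation:
  "lmonom 1 (- 2) \<star>\<^bsub>D\<^esub> lconst a = lmonom a (- 2) - lconst (2 * D a)"
proof
  fix n
  have c1: "skew_coeff (- 2) (Suc 0) = (- 2 :: 'a)" using skew_coeff_char[of 1 "- 2"] by simp
  have c2: "skew_coeff (- 2) k = (0 :: 'a)" if "k \<ge> 2" for k
  proof -
    have "(\<Prod>j<k. of_int (- 2 + 2 * int j) :: 'a) = 0"
      by (rule prod_zero) (use that in \<open>auto intro!: bexI[of _ 1]\<close>)
    then show ?thesis using skew_coeff_char[of k "- 2"] by (metis fact_nonzero mult_eq_0_iff)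
  qed
  have c2': "k = Suc 0" if "0 < k" "skew_coeff (- 2) k \<noteq> (0 :: 'a)" for k
    using c2[of k] that by (cases "k \<ge> 2") auto
  have "(lmonom 1 (- 2) \<star>\<^bsub>D\<^esub> lconst a) n = (\<Sum>(i, j, k)\<in>{(- 2 :: int, 0 :: int, 0 :: nat), (- 2, 0, 1)}.
    if i + j + 2 * int k = n then skew_coeff (- 2) k * (D ^^ k) a else 0)"
    unfolding skew_mult_def
  proof (rule sum.mono_neutral_cong)
    show "finite {(i, j, k). lmonom (1::'a) (- 2) i \<noteq> 0 \<and> lconst a j \<noteq> 0 \<and> i + j + 2 * int k = n}"
      by (rule skew_mult_index_finite[where a = "- 2" and b = 0]) (auto simp: lmonom_def)
  qed (auto simp: lmonom_def split: if_splits dest: c2')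
  also have "\<dots> = (lmonom a (- 2) - lconst (2 * D a)) n"
    by (auto simp: lmonom_def c1)
  finally show "(lmonom 1 (- 2) \<star>\<^bsub>D\<^esub> lconst a) n = (lmonom a (- 2) - lconst (2 * D a)) n" .
qed

text \<open>
  Multiplication by \<open>f\<close> multiplies each lowest coefficient by the unit \<open>a\<close>.
\<close>
lemma right_inverse_exists:
  assumes f: "starts_with f a m" and a: "a dvd 1"
  shows "\<exists>g. starts_with g (unit_inv a) (- m) \<and> f \<star>\<^bsub>D\<^esub> g = lconst 1"
proof -
  have bf: "vanishes_below m f" "f m = a" using f by (auto simp: starts_with_iff)
  have "\<exists>!g. vanishes_below (- m) (g - 0) \<and> f \<star>\<^bsub>D\<^esub> g = lconst 1"
  proof (rule successive_approximation[where u = "\<lambda>_. a" and s = m])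
    fix x x' :: "int \<Rightarrow> 'a" and n
    assume n: "n \<ge> - m" and x: "vanishes_below (- m) (x - 0)" and d: "vanishes_below n (x' - x)"
    have xl: "x \<in> laurent_series" using x by auto
    have "(x' - x) + x \<in> laurent_series" using xl d by (intro laurent_add) auto
    then have x'l: "x' \<in> laurent_series" by simp
    have "f \<star>\<^bsub>D\<^esub> x' - f \<star>\<^bsub>D\<^esub> x = f \<star>\<^bsub>D\<^esub> (x' - x)" using xl x'l bf by (subst mult_diff_right) auto
    then show "vanishes_below (n + m) (f \<star>\<^bsub>D\<^esub> x' - f \<star>\<^bsub>D\<^esub> x) \<and> (f \<star>\<^bsub>D\<^esub> x' - f \<star>\<^bsub>D\<^esub> x) (n + m) = a * (x' - x) n"
      using mult_bound[OF bf(1) d] mult_lead[OF bf(1) d] bf(2) by (simp add: add.commute)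
  next
    have "f \<star>\<^bsub>D\<^esub> 0 = 0" using r_null[of f] bf by (auto simp: carrier_eq C_sel)
    then show "vanishes_below (- m + m) (lconst 1 - f \<star>\<^bsub>D\<^esub> 0)" by (simp add: vanishes_below_def lmonom_def)
  qed (rule a)
  then obtain g where g: "vanishes_below (- m) g" "f \<star>\<^bsub>D\<^esub> g = lconst 1" by auto
  have "a * g (- m) = 1" using mult_lead[OF bf(1) g(1)] bf(2) g(2) by (simp add: lmonom_def)
  then have "g (- m) = unit_inv a" by (metis unit_inv_eqI)
  then show ?thesis using g by (auto simp: starts_with_iff)
qed

lemma starts_with_unit_inverse:
  assumes f: "starts_with f a m" and a: "a dvd 1"
  shows "f \<in> Units C" "starts_with (inv\<^bsub>C\<^esub> f) (unit_inv a) (- m)"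
proof -
  obtain g where g: "starts_with g (unit_inv a) (- m)" "f \<star>\<^bsub>D\<^esub> g = lconst 1"
    using right_inverse_exists[OF assms] by blast
  obtain h where h: "h \<in> laurent_series" "g \<star>\<^bsub>D\<^esub> h = lconst 1"
    using right_inverse_exists[OF g(1) unit_inv_unit[OF a]] by (blast dest: starts_with_laurent)
  have fl: "f \<in> laurent_series" and gl: "g \<in> laurent_series"
    using f g(1) by (auto dest: starts_with_laurent)
  have "f = h" using inv_unique[of f g h] fl gl h g(2) by (simp add: carrier_eq C_sel)
  then have gf: "g \<star>\<^bsub>D\<^esub> f = lconst 1" using h by simp
  show U: "f \<in> Units C" using fl gl gf g(2) by (auto simp: Units_def carrier_eq C_sel)
  have "inv\<^bsub>C\<^esub> f = g"
    using inv_unique[of "inv\<^bsub>C\<^esub> f" f g] Units_l_inv[OF U] Units_inv_closed[OF U] fl gl g(2)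
    by (simp add: carrier_eq C_sel)
  then show "starts_with (inv\<^bsub>C\<^esub> f) (unit_inv a) (- m)" using g(1) by simp
qed

text \<open>
  Squaring is linearised around a series \<open>x\<close> that starts with $a y^m$: a perturbation with lowest
  term $c y^n$ changes $x^2$ by $2 a c y^{m+n} + \cdots$.
\<close>
lemma square_root_unique:
  assumes g: "starts_with g (a\<^sup>2) (2 * m)" and a: "a dvd 1" and two: "(2::'a) dvd 1"
  shows "\<exists>!v. starts_with v a m \<and> v \<star>\<^bsub>D\<^esub> v = g"
proof -
  have a2: "2 * a dvd 1" using a two by (metis mult_dvd_mono mult_1)
  have "\<exists>!v. vanishes_below (m + 1) (v - lmonom a m) \<and> v \<star>\<^bsub>D\<^esub> v = g"
  proof (rule successive_approximation[where u = "\<lambda>_. 2 * a" and s = m])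
    fix x x' :: "int \<Rightarrow> 'a" and n
    assume n: "n \<ge> m + 1" and x: "vanishes_below (m + 1) (x - lmonom a m)" and d: "vanishes_below n (x' - x)"
    have sx: "starts_with x a m" unfolding starts_with_def
      using vanishes_belowD[OF x, of m] vanishes_belowD[OF x] by (auto simp: lmonom_def split: if_splits)
    then have xl: "x \<in> laurent_series" and xv: "vanishes_below m x" "x m = a"
      by (auto simp: starts_with_iff)
    have "(x' - x) + x \<in> laurent_series" using xl d by (intro laurent_add) auto
    then have x'l: "x' \<in> laurent_series" by simp
    have x'v: "vanishes_below m x'" "x' m = a"
      using xv n vanishes_belowD[OF d] by (auto simp: vanishes_below_def)
    have eq: "x' \<star>\<^bsub>D\<^esub> x' - x \<star>\<^bsub>D\<^esub> x = x' \<star>\<^bsub>D\<^esub> (x' - x) + (x' - x) \<star>\<^bsub>D\<^esub> x"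
      using xl x'l by (simp add: mult_diff_left mult_diff_right)
    have bounds: "vanishes_below (m + n) (x' \<star>\<^bsub>D\<^esub> (x' - x))" "vanishes_below (n + m) ((x' - x) \<star>\<^bsub>D\<^esub> x)"
      by (rule mult_bound[OF x'v(1) d], rule mult_bound[OF d xv(1)])
    have leads: "(x' \<star>\<^bsub>D\<^esub> (x' - x)) (m + n) = a * (x' - x) n" "((x' - x) \<star>\<^bsub>D\<^esub> x) (n + m) = (x' - x) n * a"
      using mult_lead[OF x'v(1) d] mult_lead[OF d xv(1)] x'v(2) xv(2) by auto
    show "vanishes_below (n + m) (x' \<star>\<^bsub>D\<^esub> x' - x \<star>\<^bsub>D\<^esub> x) \<and>
        (x' \<star>\<^bsub>D\<^esub> x' - x \<star>\<^bsub>D\<^esub> x) (n + m) = 2 * a * (x' - x) n"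
    proof
      show "vanishes_below (n + m) (x' \<star>\<^bsub>D\<^esub> x' - x \<star>\<^bsub>D\<^esub> x)"
        unfolding eq by (rule vanishes_below_add) (use bounds in \<open>simp_all only: add.commute\<close>)
      have "(x' \<star>\<^bsub>D\<^esub> x' - x \<star>\<^bsub>D\<^esub> x) (n + m) = a * (x' - x) n + (x' - x) n * a"
        unfolding eq plus_fun_apply leads(2) leads(1)[folded add.commute[of n m]] ..
      then show "(x' \<star>\<^bsub>D\<^esub> x' - x \<star>\<^bsub>D\<^esub> x) (n + m) = 2 * a * (x' - x) n"
        by (simp only: mult_2 distrib_right mult.commute[of "(x' - x) n" a])
    qed
  next
    have "starts_with (lmonom a m \<star>\<^bsub>D\<^esub> lmonom a m) (a * a) (m + m)" by (intro starts_with_mult) auto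
    then have "vanishes_below (m + m + 1) (g - lmonom a m \<star>\<^bsub>D\<^esub> lmonom a m)"
      using g by (intro vanishes_below_Suc)
        (auto simp: starts_with_iff power2_eq_square mult_2[symmetric] intro: vanishes_below_diff)
    then show "vanishes_below (m + 1 + m) (g - lmonom a m \<star>\<^bsub>D\<^esub> lmonom a m)" by (simp add: add_ac)
  qed (rule a2)
  moreover have "vanishes_below (m + 1) (v - lmonom a m) \<longleftrightarrow> starts_with v a m" for v
    by (auto simp: vanishes_below_def starts_with_def lmonom_def zless_add1_eq)
  ultimately show ?thesis by simp
qed

lemma two_unit: "(2::'a) dvd 1"
proof -
  obtain b :: 'a where "of_nat 2 * b = 1" using S unfolding rational_subring_def by (metis zero_less_numeral)
  then show ?thesis by (metis dvd_def of_nat_numeral)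
qed

end

section \<open>Substituting a series into skew Laurent series\<close>

text \<open>
  Integer powers of a unit can be computed in the group of units, where the power laws hold.
\<close>
lemma (in monoid) units_of_int_pow:
  assumes "x \<in> Units G"
  shows "x [^]\<^bsub>units_of G\<^esub> (i::int) = x [^] i"
proof -
  interpret U: group "units_of G" by (rule units_group)
  have n: "x [^]\<^bsub>units_of G\<^esub> n = x [^] n" for n :: nat
    by (induction n) (simp_all only: nat_pow_0 nat_pow_Suc U.nat_pow_0 U.nat_pow_Suc units_of_mult units_of_one)
  have "x [^] n \<in> Units G" for n :: nat
    using U.nat_pow_closed[of x n] assms by (simp add: units_of_carrier n)
  then show ?thesis by (simp add: int_pow_def2 n units_of_inv del: pow_nat)
qed

lemma (in monoid) Units_int_pow_add:
  assumes "x \<in> Units G"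
  shows "x [^] (i + j :: int) = x [^] i \<otimes> x [^] j"
  using group.int_pow_mult[OF units_group, of x i j] assms
  by (simp add: units_of_carrier units_of_int_pow units_of_mult)

lemma (in monoid) Units_int_pow_1:
  assumes "x \<in> Units G"
  shows "x [^] (1 :: int) = x"
  using group.int_pow_1[OF units_group, of x] assms by (simp add: units_of_carrier units_of_int_pow)

lemma (in monoid) Units_int_pow_minus:
  assumes "x \<in> Units G"
  shows "x [^] (- i :: int) = inv (x [^] i)"
  using group.int_pow_neg[OF units_group, of x i] group.int_pow_closed[OF units_group, of x i] assms
  by (simp add: units_of_carrier units_of_int_pow units_of_inv)

text \<open>
  The only commutation rule required of \<open>v\<close> is the one for $v^{-2}$.  Those for all other powers of \<open>v\<close>,
  in particular the one for \<open>v\<close> itself, are consequences.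
\<close>
locale skew_substitution = C: skew_full \<delta> + C': skew_full \<Delta>
  for \<delta> \<Delta> :: "'a::{idom, ring_char_0} \<Rightarrow> 'a" +
  fixes v :: "int \<Rightarrow> 'a" and \<epsilon> :: 'a
  assumes v: "starts_with v \<epsilon> 1" and \<epsilon>: "\<epsilon> dvd 1"
    and v_inv_square_commutation:
      "\<And>a. inv\<^bsub>C.C\<^esub> (v \<star>\<^bsub>\<delta>\<^esub> v) \<star>\<^bsub>\<delta>\<^esub> lconst a
         = lconst a \<star>\<^bsub>\<delta>\<^esub> inv\<^bsub>C.C\<^esub> (v \<star>\<^bsub>\<delta>\<^esub> v) - lconst (2 * \<Delta> a)"
begin

abbreviation V :: "int \<Rightarrow> int \<Rightarrow> 'a" where "V i \<equiv> v [^]\<^bsub>C.C\<^esub> i"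

abbreviation \<Phi> :: "(int \<Rightarrow> 'a) \<Rightarrow> int \<Rightarrow> 'a" where "\<Phi> \<equiv> laurent_subst C.C v"

lemma v_unit: "v \<in> Units C.C"
  using C.starts_with_unit_inverse(1)[OF v \<epsilon>] .

lemma V_0: "V 0 = lconst 1"
  by (simp add: C.C_sel)

lemma V_1: "V 1 = v"
  by (rule C.Units_int_pow_1[OF v_unit])

lemma V_add: "V (i + j) = V i \<star>\<^bsub>\<delta>\<^esub> V j"
  using C.Units_int_pow_add[OF v_unit] by (simp add: C.C_sel)

lemma V_minus_2: "V (- 2) = inv\<^bsub>C.C\<^esub> (v \<star>\<^bsub>\<delta>\<^esub> v)"
  using C.Units_int_pow_minus[OF v_unit, of 2] V_add[of 1 1] by (simp add: V_1)

lemma V_starts: "V i i dvd 1 \<and> starts_with (V i) (V i i) i"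
proof -
  have "\<exists>u. u dvd 1 \<and> starts_with (V i) u i"
  proof (induction i rule: int_induct[where k = 0])
    case base
    show ?case unfolding V_0 by (intro exI[of _ 1]) simp
  next
    case (step1 i)
    then obtain u where "u dvd 1" "starts_with (V i) u i" by auto
    then have "u * \<epsilon> dvd 1" "starts_with (V (i + 1)) (u * \<epsilon>) (i + 1)"
      using C.starts_with_mult[OF _ v, of "V i" u i] \<epsilon> by (auto simp: V_add V_1 intro: mult_dvd_mono[of _ 1 _ 1, simplified])
    then show ?case by blast
  next
    case (step2 i)
    then obtain u where u: "u dvd 1" "starts_with (V i) u i" by auto
    have "V (- 1) = inv\<^bsub>C.C\<^esub> v" using C.Units_int_pow_minus[OF v_unit, of 1] by (simp add: V_1)
    then have "starts_with (V (- 1)) (unit_inv \<epsilon>) (- 1)"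
      using C.starts_with_unit_inverse(2)[OF v \<epsilon>] by simp
    then have "u * unit_inv \<epsilon> dvd 1" "starts_with (V (i - 1)) (u * unit_inv \<epsilon>) (i - 1)"
      using C.starts_with_mult[of "V i" u i "V (- 1)" "unit_inv \<epsilon>" "- 1"] V_add[of i "- 1"]
        unit_inv_unit[OF \<epsilon>] u
      by (auto intro: mult_dvd_mono[of _ 1 _ 1, simplified])
    then show ?case by blast
  qed
  then show ?thesis by (auto simp: starts_with_iff)
qed

lemma V_bound: "vanishes_below i (V i)"
  using V_starts by (simp add: starts_with_iff)

lemma V_laurent [simp]: "V i \<in> laurent_series"
  using V_bound by auto

lemma V_inverse: "f \<in> laurent_series \<Longrightarrow> V i \<star>\<^bsub>\<delta>\<^esub> (V (- i) \<star>\<^bsub>\<delta>\<^esub> f) = f"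
  by (simp add: C.mult_assoc[symmetric] V_add[symmetric] V_0[simplified])

lemma subst_coeff:
  assumes "vanishes_below a f"
  shows "\<Phi> f n = (\<Sum>i\<in>{a..n}. f i * V i n)"
proof -
  have "\<Phi> f n = (\<Sum>i | f i * V i n \<noteq> 0. f i * V i n)"
    by (simp add: laurent_subst_def C.C_sel C.mult_const_left)
  also have "\<dots> = (\<Sum>i\<in>{a..n}. f i * V i n)"
  proof (rule sum.mono_neutral_left)
    show "{i. f i * V i n \<noteq> 0} \<subseteq> {a..n}"
      using assms V_bound by (auto simp: vanishes_below_def) (metis not_le)+
  qed auto
  finally show ?thesis .
qed

lemma subst_filtered: "filtered_additive 0 \<Phi>"
proof (rule filtered_additiveI)
  fix f g :: "int \<Rightarrow> 'a" assume "f \<in> laurent_series" "g \<in> laurent_series"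
  then obtain a where a: "vanishes_below a f" "vanishes_below a g" by (rule laurent_common_bound)
  show "\<Phi> (f + g) = \<Phi> f + \<Phi> g"
    by (rule ext) (simp add: a vanishes_below_add subst_coeff[where a = a] sum.distrib algebra_simps)
next
  fix m and f :: "int \<Rightarrow> 'a" assume "vanishes_below m f"
  then show "vanishes_below (m + 0) (\<Phi> f)" by (simp add: vanishes_below_def subst_coeff[where a = m])
qed

lemma subst_laurent [simp]: "f \<in> laurent_series \<Longrightarrow> \<Phi> f \<in> laurent_series"
  by (rule filtered_additive_closed[OF subst_filtered])

lemma subst_lead: "vanishes_below m f \<Longrightarrow> \<Phi> f m = f m * V m m"
  by (simp add: subst_coeff[where a = m])

lemma subst_monom: "\<Phi> (lmonom a j) = lconst a \<star>\<^bsub>\<delta>\<^esub> V j"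
proof
  fix n
  have "(if i = j then a else 0) * V i n = (if i = j then a * V i n else 0)" for i by simp
  then have "\<Phi> (lmonom a j) n = (if j \<le> n then a * V j n else 0)"
    by (subst subst_coeff[of j]) (simp, simp add: lmonom_def)
  then show "\<Phi> (lmonom a j) n = (lconst a \<star>\<^bsub>\<delta>\<^esub> V j) n"
    using V_bound[of j] by (simp add: C.mult_const_left vanishes_below_def)
qed

lemma subst_const: "\<Phi> (lconst a) = lconst a"
  by (simp add: subst_monom V_0[simplified])

text \<open>
  The map is triangular with the units \<open>V n n\<close> on the diagonal.
\<close>
lemma subst_ex1:
  assumes "g \<in> laurent_series"
  shows "\<exists>!f. f \<in> laurent_series \<and> \<Phi> f = g"
proof -
  have step: "\<exists>!f. vanishes_below m (f - 0) \<and> \<Phi> f = g" if m: "vanishes_below m g" for m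
  proof (rule successive_approximation[where u = "\<lambda>n. V n n" and s = 0])
    fix x x' :: "int \<Rightarrow> 'a" and n
    assume n: "n \<ge> m" and x: "vanishes_below m (x - 0)" and d: "vanishes_below n (x' - x)"
    have xl: "x \<in> laurent_series" using x by auto
    have "(x' - x) + x \<in> laurent_series" using xl d by (intro laurent_add) auto
    then have x'l: "x' \<in> laurent_series" by simp
    show "vanishes_below (n + 0) (\<Phi> x' - \<Phi> x) \<and> (\<Phi> x' - \<Phi> x) (n + 0) = V n n * (x' - x) n"
      using filtered_additive_bound[OF subst_filtered d] subst_lead[OF d]
      unfolding filtered_additive_minus[OF subst_filtered x'l xl] by simp
  next
    have "\<Phi> 0 = 0" using filtered_additive_minus[OF subst_filtered, of 0 0] by simp
    then show "vanishes_below (m + 0) (g - \<Phi> 0)" using m by simp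
  qed (use V_starts in auto)
  show ?thesis
  proof (rule ex_ex1I)
    obtain m where m: "vanishes_below m g" using assms by (rule laurentE)
    then show "\<exists>f. f \<in> laurent_series \<and> \<Phi> f = g" using step[OF m] by auto
  next
    fix f f' assume f: "f \<in> laurent_series \<and> \<Phi> f = g" and f': "f' \<in> laurent_series \<and> \<Phi> f' = g"
    obtain m where m: "vanishes_below m f" "vanishes_below m f'" using f f' by (meson laurent_common_bound)
    have "vanishes_below m g" using filtered_additive_bound[OF subst_filtered m(1)] f by simp
    from step[OF this] show "f = f'" using m f f' by auto
  qed
qed

lemma subst_bij: "bij_betw \<Phi> laurent_series laurent_series"
proof (rule bij_betwI')
  fix f g :: "int \<Rightarrow> 'a" assume "f \<in> laurent_series" "g \<in> laurent_series"
  then show "\<Phi> f = \<Phi> g \<longleftrightarrow> f = g" using subst_ex1[OF subst_laurent] by metis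
next
  fix g :: "int \<Rightarrow> 'a" assume "g \<in> laurent_series"
  then show "\<exists>f\<in>laurent_series. g = \<Phi> f" using subst_ex1[of g] by blast
qed simp

lemma subst_const_mult: "f \<in> laurent_series \<Longrightarrow> \<Phi> (lconst a \<star>\<^bsub>\<Delta>\<^esub> f) = lconst a \<star>\<^bsub>\<delta>\<^esub> \<Phi> f"
proof -
  assume f: "f \<in> laurent_series"
  then obtain m where m: "vanishes_below m f" by (rule laurentE)
  then have "vanishes_below m (\<lambda>n. a * f n)" by (simp add: vanishes_below_def)
  then show ?thesis using m f
    by (intro ext) (simp add: C'.mult_const_left C.mult_const_left subst_coeff[where a = m] sum_distrib_left mult.assoc)
qed

lemma subst_mult_y_power:
  assumes "f \<in> laurent_series"
  shows "\<Phi> (f \<star>\<^bsub>\<Delta>\<^esub> lmonom 1 j) = \<Phi> f \<star>\<^bsub>\<delta>\<^esub> V j"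
proof (rule filtered_additive_ext[OF _ _ _ assms])
  show "filtered_additive (j + 0) (\<lambda>f. \<Phi> (f \<star>\<^bsub>\<Delta>\<^esub> lmonom 1 j))"
    by (intro filtered_additive_comp[OF subst_filtered] C'.filtered_additive_mult_right) simp
  show "filtered_additive (0 + j) (\<lambda>f. \<Phi> f \<star>\<^bsub>\<delta>\<^esub> V j)"
    by (intro filtered_additive_comp[OF _ subst_filtered] C.filtered_additive_mult_right V_bound)
qed (simp add: subst_monom V_add C.mult_assoc)

text \<open>
  The exponents with this property form a subgroup of the integers.  It contains $-2$, and the
  point is to show that it contains $1$.
\<close>
definition left_multiplicative :: "int \<Rightarrow> bool" where
  "left_multiplicative i \<longleftrightarrow> (\<forall>g\<in>laurent_series. \<Phi> (lmonom 1 i \<star>\<^bsub>\<Delta>\<^esub> g) = V i \<star>\<^bsub>\<delta>\<^esub> \<Phi> g)"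

lemma left_multiplicativeD:
  "left_multiplicative i \<Longrightarrow> g \<in> laurent_series \<Longrightarrow> \<Phi> (lmonom 1 i \<star>\<^bsub>\<Delta>\<^esub> g) = V i \<star>\<^bsub>\<delta>\<^esub> \<Phi> g"
  by (simp add: left_multiplicative_def)

lemma left_multiplicative_add:
  assumes "left_multiplicative i" "left_multiplicative j"
  shows "left_multiplicative (i + j)"
  unfolding left_multiplicative_def
proof
  fix g :: "int \<Rightarrow> 'a" assume g: "g \<in> laurent_series"
  have "\<Phi> (lmonom 1 (i + j) \<star>\<^bsub>\<Delta>\<^esub> g) = \<Phi> (lmonom 1 i \<star>\<^bsub>\<Delta>\<^esub> (lmonom 1 j \<star>\<^bsub>\<Delta>\<^esub> g))"
    using g by (simp add: C'.mult_assoc[symmetric])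
  also have "\<dots> = V i \<star>\<^bsub>\<delta>\<^esub> (V j \<star>\<^bsub>\<delta>\<^esub> \<Phi> g)"
    using assms g by (simp add: left_multiplicativeD)
  finally show "\<Phi> (lmonom 1 (i + j) \<star>\<^bsub>\<Delta>\<^esub> g) = V (i + j) \<star>\<^bsub>\<delta>\<^esub> \<Phi> g"
    using g by (simp add: V_add C.mult_assoc)
qed

lemma left_multiplicative_minus:
  assumes "left_multiplicative i"
  shows "left_multiplicative (- i)"
  unfolding left_multiplicative_def
proof
  fix g :: "int \<Rightarrow> 'a" assume g: "g \<in> laurent_series"
  have "V i \<star>\<^bsub>\<delta>\<^esub> \<Phi> (lmonom 1 (- i) \<star>\<^bsub>\<Delta>\<^esub> g) = \<Phi> (lmonom 1 i \<star>\<^bsub>\<Delta>\<^esub> (lmonom 1 (- i) \<star>\<^bsub>\<Delta>\<^esub> g))"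
    using assms g by (simp add: left_multiplicativeD)
  also have "\<dots> = \<Phi> g" using g by (simp add: C'.mult_assoc[symmetric])
  finally have "V (- i) \<star>\<^bsub>\<delta>\<^esub> (V i \<star>\<^bsub>\<delta>\<^esub> \<Phi> (lmonom 1 (- i) \<star>\<^bsub>\<Delta>\<^esub> g)) = V (- i) \<star>\<^bsub>\<delta>\<^esub> \<Phi> g" by simp
  then show "\<Phi> (lmonom 1 (- i) \<star>\<^bsub>\<Delta>\<^esub> g) = V (- i) \<star>\<^bsub>\<delta>\<^esub> \<Phi> g"
    using V_inverse[of "\<Phi> (lmonom 1 (- i) \<star>\<^bsub>\<Delta>\<^esub> g)" "- i"] g by simp
qed

text \<open>
  On monomials this is the relation assumed for $v^{-2}$ compared with that for $z^{-2}$.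
\<close>
lemma left_multiplicative_minus_2: "left_multiplicative (- 2)"
  unfolding left_multiplicative_def
proof
  fix g :: "int \<Rightarrow> 'a" assume g: "g \<in> laurent_series"
  show "\<Phi> (lmonom 1 (- 2) \<star>\<^bsub>\<Delta>\<^esub> g) = V (- 2) \<star>\<^bsub>\<delta>\<^esub> \<Phi> g"
  proof (rule filtered_additive_ext[OF _ _ _ g])
    show "filtered_additive (- 2 + 0) (\<lambda>g. \<Phi> (lmonom 1 (- 2) \<star>\<^bsub>\<Delta>\<^esub> g))"
      by (intro filtered_additive_comp[OF subst_filtered] C'.filtered_additive_mult_left) simp
    show "filtered_additive (0 + (- 2)) (\<lambda>g. V (- 2) \<star>\<^bsub>\<delta>\<^esub> \<Phi> g)"
      by (intro filtered_additive_comp[OF _ subst_filtered] C.filtered_additive_mult_left V_bound)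
    fix b j
    have "\<Phi> (lmonom 1 (- 2) \<star>\<^bsub>\<Delta>\<^esub> lmonom b j) = \<Phi> ((lmonom 1 (- 2) \<star>\<^bsub>\<Delta>\<^esub> lconst b) \<star>\<^bsub>\<Delta>\<^esub> lmonom 1 j)"
      by (simp add: C'.mult_assoc)
    also have "\<dots> = \<Phi> (lmonom b (- 2) - lconst (2 * \<Delta> b)) \<star>\<^bsub>\<delta>\<^esub> V j"
      by (simp add: subst_mult_y_power C'.y_inv_square_commutation)
    also have "\<Phi> (lmonom b (- 2) - lconst (2 * \<Delta> b)) = V (- 2) \<star>\<^bsub>\<delta>\<^esub> lconst b"
      using v_inv_square_commutation[of b] unfolding V_minus_2[symmetric]
      by (simp add: filtered_additive_minus[OF subst_filtered] subst_const subst_monom[of b "- 2"])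
    finally show "\<Phi> (lmonom 1 (- 2) \<star>\<^bsub>\<Delta>\<^esub> lmonom b j) = V (- 2) \<star>\<^bsub>\<delta>\<^esub> \<Phi> (lmonom b j)"
      by (simp add: subst_monom C.mult_assoc)
  qed
qed

text \<open>
  The rule for $z^2$ determines the rule for its square root $z$ because $2$ and the leading
  coefficient of \<open>v\<close> are not zero divisors.  The defect \<open>u\<close> measures the failure of the claim;
  it turns left multiplication by $z$ into that by \<open>-v\<close>, and right multiplication by $z$ into that
  by \<open>v\<close>, although $z g$ and $g z$ have the same leading term.  So its leading terms vanish.
\<close>
lemma left_multiplicative_1: "left_multiplicative 1"
proof -
  let ?z = "lmonom 1 1 :: int \<Rightarrow> 'a"
  define u where "u = (\<lambda>g. v \<star>\<^bsub>\<delta>\<^esub> \<Phi> g - \<Phi> (?z \<star>\<^bsub>\<Delta>\<^esub> g))"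
  have vb: "vanishes_below 1 v" "v 1 = \<epsilon>" using v by (auto simp: starts_with_iff)
  have vl: "v \<in> laurent_series" using vb by auto
  have u1: "filtered_additive 1 u"
  proof -
    have "filtered_additive (0 + 1) (\<lambda>g. v \<star>\<^bsub>\<delta>\<^esub> \<Phi> g)"
      by (intro filtered_additive_comp[OF _ subst_filtered] C.filtered_additive_mult_left vb)
    moreover have "filtered_additive (1 + 0) (\<lambda>g. \<Phi> (?z \<star>\<^bsub>\<Delta>\<^esub> g))"
      by (intro filtered_additive_comp[OF subst_filtered] C'.filtered_additive_mult_left) simp
    ultimately show ?thesis unfolding u_def by (intro filtered_additive_diff) simp_all
  qed
  have ul: "u g \<in> laurent_series" if "g \<in> laurent_series" for g
    using filtered_additive_closed[OF u1 that] .
  have anticommute: "v \<star>\<^bsub>\<delta>\<^esub> u g + u (?z \<star>\<^bsub>\<Delta>\<^esub> g) = 0" if g: "g \<in> laurent_series" for g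
  proof -
    have "v \<star>\<^bsub>\<delta>\<^esub> (v \<star>\<^bsub>\<delta>\<^esub> \<Phi> g) = \<Phi> (?z \<star>\<^bsub>\<Delta>\<^esub> (?z \<star>\<^bsub>\<Delta>\<^esub> g))"
      using left_multiplicativeD[OF left_multiplicative_minus[OF left_multiplicative_minus_2] g] g V_add[of 1 1] vl
      by (simp add: V_1 C.mult_assoc C'.mult_assoc[symmetric])
    then show ?thesis using g vl by (simp add: u_def C.mult_diff_right)
  qed
  have u_shift: "u (g \<star>\<^bsub>\<Delta>\<^esub> ?z) = u g \<star>\<^bsub>\<delta>\<^esub> v" if g: "g \<in> laurent_series" for g
    using g vl subst_mult_y_power[of _ 1]
    by (simp add: u_def V_1 C'.mult_assoc[symmetric] C.mult_assoc C.mult_diff_left)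
  \<comment> \<open>If u raises the valuation by 1 + c, the identity v u(g) + u(z g) = 0, read in the lowest
    possible degree, shows that it raises the valuation by one more.\<close>
  have bound: "filtered_additive (1 + int c) u" for c
  proof (induction c)
    case 0
    then show ?case using u1 by simp
  next
    case (Suc c)
    have "vanishes_below (m + (1 + int c) + 1) (u g)" if g: "vanishes_below m g" for m g
    proof (rule vanishes_below_Suc)
      let ?k = "m + (1 + int c)"
      have gl: "g \<in> laurent_series" using g by auto
      show ug: "vanishes_below ?k (u g)" using filtered_additive_bound[OF Suc g] .
      define r where "r = ?z \<star>\<^bsub>\<Delta>\<^esub> g - g \<star>\<^bsub>\<Delta>\<^esub> ?z"
      have rl: "r \<in> laurent_series" using gl by (simp add: r_def)
      have "vanishes_below (m + 1 + 1) r"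
      proof (rule vanishes_below_Suc)
        have z: "vanishes_below 1 ?z" by simp
        show "vanishes_below (m + 1) r" unfolding r_def
          using C'.mult_bound[OF z g] C'.mult_bound[OF g z] by (simp add: vanishes_below_diff add.commute)
        show "r (m + 1) = 0"
          using C'.mult_lead[OF z g] C'.mult_lead[OF g z] by (simp add: r_def add.commute[of 1])
      qed
      then have "vanishes_below (m + 1 + 1 + (1 + int c)) (u r)" by (rule filtered_additive_bound[OF Suc])
      then have ur: "u r (?k + 1) = 0" by (rule vanishes_belowD) simp
      have "u (?z \<star>\<^bsub>\<Delta>\<^esub> g) = u (g \<star>\<^bsub>\<Delta>\<^esub> ?z) + u r"
        using filtered_additive_add[OF u1, of "g \<star>\<^bsub>\<Delta>\<^esub> ?z" r] gl rl by (simp add: r_def)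
      then have "v \<star>\<^bsub>\<delta>\<^esub> u g + (u g \<star>\<^bsub>\<delta>\<^esub> v + u r) = 0" using anticommute[OF gl] u_shift[OF gl] by simp
      then have "(v \<star>\<^bsub>\<delta>\<^esub> u g + (u g \<star>\<^bsub>\<delta>\<^esub> v + u r)) (?k + 1) = 0" by simp
      then have "\<epsilon> * u g ?k + u g ?k * \<epsilon> = 0"
        using C.mult_lead[OF vb(1) ug] C.mult_lead[OF ug vb(1)] vb(2) ur by (simp add: add.commute[of 1])
      then have "2 * \<epsilon> * u g ?k = 0" by (simp add: mult_ac)
      moreover have "\<epsilon> \<noteq> 0" using \<epsilon> by auto
      ultimately show "u g ?k = 0" by simp
    qed
    then have "vanishes_below (m + (1 + int (Suc c))) (u g)" if "vanishes_below m g" for m g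
      using that by (simp add: add_ac)
    then show ?case using u1 unfolding filtered_additive_def by blast
  qed
  have "u g = 0" if "g \<in> laurent_series" for g
  proof
    fix n
    obtain m where m: "vanishes_below m g" using \<open>g \<in> laurent_series\<close> by (rule laurentE)
    have "vanishes_below (m + (1 + int (nat (n - m)))) (u g)" by (rule filtered_additive_bound[OF bound m])
    then have "u g n = 0" by (rule vanishes_belowD) simp
    then show "u g n = 0 n" by simp
  qed
  then show ?thesis by (simp add: left_multiplicative_def u_def V_1)
qed

lemma left_multiplicative: "left_multiplicative i"
proof (induction i rule: int_induct[where k = 0])
  case base
  then show ?case using left_multiplicative_add[OF left_multiplicative_1 left_multiplicative_minus[OF left_multiplicative_1]] by simp
next
  case (step1 i)
  then show ?case by (intro left_multiplicative_add left_multiplicative_1)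
next
  case (step2 i)
  then show ?case using left_multiplicative_add[OF _ left_multiplicative_minus[OF left_multiplicative_1]] by fastforce
qed

text \<open>
  By continuity the left factor may be taken to be a monomial.
\<close>
lemma subst_mult:
  assumes f: "f \<in> laurent_series" and g: "g \<in> laurent_series"
  shows "\<Phi> (f \<star>\<^bsub>\<Delta>\<^esub> g) = \<Phi> f \<star>\<^bsub>\<delta>\<^esub> \<Phi> g"
proof -
  obtain m where m: "vanishes_below m g" using g by (rule laurentE)
  have m': "vanishes_below m (\<Phi> g)" using filtered_additive_bound[OF subst_filtered m] by simp
  show ?thesis
  proof (rule filtered_additive_ext[OF _ _ _ f])
    show "filtered_additive (m + 0) (\<lambda>f. \<Phi> (f \<star>\<^bsub>\<Delta>\<^esub> g))"
      by (intro filtered_additive_comp[OF subst_filtered] C'.filtered_additive_mult_right m)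
    show "filtered_additive (0 + m) (\<lambda>f. \<Phi> f \<star>\<^bsub>\<delta>\<^esub> \<Phi> g)"
      by (intro filtered_additive_comp[OF _ subst_filtered] C.filtered_additive_mult_right m')
    fix a j
    have "\<Phi> (lmonom a j \<star>\<^bsub>\<Delta>\<^esub> g) = \<Phi> (lconst a \<star>\<^bsub>\<Delta>\<^esub> (lmonom 1 j \<star>\<^bsub>\<Delta>\<^esub> g))"
      using g by (simp add: C'.mult_assoc[symmetric])
    also have "\<dots> = lconst a \<star>\<^bsub>\<delta>\<^esub> (V j \<star>\<^bsub>\<delta>\<^esub> \<Phi> g)"
      using g by (simp add: subst_const_mult left_multiplicativeD[OF left_multiplicative])
    finally show "\<Phi> (lmonom a j \<star>\<^bsub>\<Delta>\<^esub> g) = \<Phi> (lmonom a j) \<star>\<^bsub>\<delta>\<^esub> \<Phi> g"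
      using g by (simp add: subst_monom C.mult_assoc)
  qed
qed

end

section \<open>Automorphisms stabilizing the coefficient ring\<close>

lemma lmonom_add: "lmonom a m + lmonom b m = lmonom (a + b :: 'a::monoid_add) m"
  by (rule ext) (simp add: lmonom_def)

lemma lmonom_1_nonzero: "lmonom 1 m \<noteq> (0 :: int \<Rightarrow> 'a::zero_neq_one)"
  by (metis lmonom_def zero_fun_apply zero_neq_one)

lemma lmonom_inject [simp]: "lmonom a m = lmonom b m \<longleftrightarrow> a = b"
  by (metis lmonom_def)

text \<open>
  The inverse \<open>\<tau>\<close> is part of the data, so that every result about \<open>\<theta>\<close> also holds for \<open>\<tau>\<close>.
\<close>
locale const_automorphism = skew_full D for D :: "'a::{idom, ring_char_0} \<Rightarrow> 'a" +
  fixes \<theta> \<tau> :: "(int \<Rightarrow> 'a) \<Rightarrow> int \<Rightarrow> 'a"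
  assumes \<theta>_hom: "\<theta> \<in> ring_hom C C" and \<tau>_hom: "\<tau> \<in> ring_hom C C"
    and \<theta>_\<tau>: "f \<in> laurent_series \<Longrightarrow> \<theta> (\<tau> f) = f" and \<tau>_\<theta>: "f \<in> laurent_series \<Longrightarrow> \<tau> (\<theta> f) = f"
    and \<theta>_const: "\<exists>b. \<theta> (lconst a) = lconst b" and \<tau>_const: "\<exists>b. \<tau> (lconst a) = lconst b"
begin

lemma inverse_automorphism: "const_automorphism D \<tau> \<theta>"
  by unfold_locales (simp_all add: \<theta>_hom \<tau>_hom \<theta>_\<tau> \<tau>_\<theta> \<theta>_const \<tau>_const)

lemma \<theta>_laurent [simp]: "f \<in> laurent_series \<Longrightarrow> \<theta> f \<in> laurent_series"
  using ring_hom_closed[OF \<theta>_hom] by (simp add: carrier_eq)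

lemma \<theta>_mult: "f \<in> laurent_series \<Longrightarrow> g \<in> laurent_series \<Longrightarrow> \<theta> (f \<star>\<^bsub>D\<^esub> g) = \<theta> f \<star>\<^bsub>D\<^esub> \<theta> g"
  using ring_hom_mult[OF \<theta>_hom, of f g] by (simp add: carrier_eq C_sel)

lemma \<theta>_add: "f \<in> laurent_series \<Longrightarrow> g \<in> laurent_series \<Longrightarrow> \<theta> (f + g) = \<theta> f + \<theta> g"
  using ring_hom_add[OF \<theta>_hom, of f g] by (simp add: carrier_eq C_sel)

lemma \<theta>_one [simp]: "\<theta> (lconst 1) = lconst 1"
  using ring_hom_one[OF \<theta>_hom] by (simp add: C_sel)

lemma \<theta>_diff: "f \<in> laurent_series \<Longrightarrow> g \<in> laurent_series \<Longrightarrow> \<theta> (f - g) = \<theta> f - \<theta> g"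
  using \<theta>_add[of "f - g" g] by simp

lemma \<theta>_0 [simp]: "\<theta> 0 = 0"
proof -
  have "\<theta> (0 - 0) = \<theta> 0 - \<theta> 0" by (rule \<theta>_diff) simp_all
  then show ?thesis by (simp only: diff_self)
qed

lemma \<theta>_eq_0_iff: "f \<in> laurent_series \<Longrightarrow> \<theta> f = 0 \<longleftrightarrow> f = 0"
  using \<tau>_\<theta>[of f] \<tau>_\<theta>[of 0] by auto

definition \<theta>\<^sub>0 :: "'a \<Rightarrow> 'a" where "\<theta>\<^sub>0 a = \<theta> (lconst a) 0"

lemma \<theta>_lconst: "\<theta> (lconst a) = lconst (\<theta>\<^sub>0 a)"
  using \<theta>_const[of a] by (auto simp: \<theta>\<^sub>0_def lmonom_def)

lemma \<theta>\<^sub>0_add: "\<theta>\<^sub>0 (a + b) = \<theta>\<^sub>0 a + \<theta>\<^sub>0 b"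
  using \<theta>_add[of "lconst a" "lconst b"] by (simp add: lmonom_add \<theta>_lconst)

lemma \<theta>\<^sub>0_mult: "\<theta>\<^sub>0 (a * b) = \<theta>\<^sub>0 a * \<theta>\<^sub>0 b"
  using \<theta>_mult[of "lconst a" "lconst b"] by (simp add: \<theta>_lconst)

lemma \<theta>\<^sub>0_0 [simp]: "\<theta>\<^sub>0 0 = 0"
  using \<theta>\<^sub>0_add[of 0 0] by simp

lemma \<theta>\<^sub>0_1 [simp]: "\<theta>\<^sub>0 1 = 1"
  using \<theta>_one by (simp add: \<theta>_lconst)

text \<open>
  An arbitrary automorphism is not known to be continuous, but it preserves squares.  If
  $1 + f = q^2$, then \<open>q\<close> has the form $1 + f'$ with $f'$ of positive valuation, and the valuation of
  the image of $1 + f$ is twice that of the image of $1 + f'$.  Repeating this, the valuation of the image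
  is divisible by every power of 2.
\<close>
lemma image_one_plus:
  assumes f: "vanishes_below 1 f"
  obtains a where "a \<noteq> 0" "starts_with (\<theta> (lconst 1 + f)) a 0"
proof -
  have zero: "m = 0" if "vanishes_below 1 f" "starts_with (\<theta> (lconst 1 + f)) a m" "a \<noteq> 0" for f a m
    using that
  proof (induction "nat \<bar>m\<bar>" arbitrary: f a m rule: less_induct)
    case less
    have "starts_with (lconst 1 + f) (1\<^sup>2) (2 * 0)"
      using less.prems(1) by (auto simp: starts_with_def vanishes_below_def lmonom_def)
    then obtain q where q: "starts_with q 1 0" "q \<star>\<^bsub>D\<^esub> q = lconst 1 + f"
      using square_root_unique[OF _ _ two_unit, of "lconst 1 + f" 1 0] by auto
    have ql: "q \<in> laurent_series" using q(1) by (rule starts_with_laurent)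
    define f' where "f' = q - lconst 1"
    have f': "vanishes_below 1 f'"
      using q(1) by (auto simp: f'_def starts_with_def vanishes_below_def lmonom_def)
    have q_eq: "q = lconst 1 + f'" by (simp add: f'_def)
    have "q \<noteq> 0" using q(1) by (auto simp: starts_with_def)
    then obtain b k where b: "b \<noteq> 0" "starts_with (\<theta> q) b k"
      using starts_with_exists[of "\<theta> q"] ql \<theta>_eq_0_iff by auto
    have "starts_with (\<theta> (lconst 1 + f)) (b * b) (k + k)"
      using starts_with_mult[OF b(2) b(2)] by (simp add: \<theta>_mult[OF ql ql, symmetric] q(2))
    then have m: "m = k + k" using starts_with_unique(2)[OF less.prems(2)] less.prems(3) b(1) by simp
    show "m = 0"
    proof (rule ccontr)
      assume "m \<noteq> 0"
      then have "nat \<bar>k\<bar> < nat \<bar>m\<bar>" using m by simp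
      from less.hyps[OF this f' b(2)[unfolded q_eq] b(1)] show False using m \<open>m \<noteq> 0\<close> by simp
    qed
  qed
  have fl: "lconst 1 + f \<in> laurent_series" using f by (intro laurent_add) auto
  have "(lconst 1 + f) 0 \<noteq> 0" using vanishes_belowD[OF f, of 0] by (simp add: lmonom_def)
  then have "lconst 1 + f \<noteq> 0" by force
  then obtain a m where a: "a \<noteq> 0" "starts_with (\<theta> (lconst 1 + f)) a m"
    using starts_with_exists[of "\<theta> (lconst 1 + f)"] fl \<theta>_eq_0_iff by auto
  then show thesis using that zero[OF f a(2,1)] by simp
qed

text \<open>
  Constants go to constants, so \<open>f\<close> may be replaced by $f - f_0 = (1 + (f - f_0)) - 1$.
\<close>
lemma image_nonneg:
  assumes f: "vanishes_below 0 f"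
  shows "vanishes_below 0 (\<theta> f)"
proof -
  define g where "g = f - lconst (f 0)"
  have g: "vanishes_below 1 g" using f by (auto simp: g_def vanishes_below_def lmonom_def)
  then have gl: "g \<in> laurent_series" by auto
  obtain a where a: "starts_with (\<theta> (lconst 1 + g)) a 0" using image_one_plus[OF g] by blast
  have "f = lconst (f 0) + ((lconst 1 + g) - lconst 1)" by (simp add: g_def)
  then have "\<theta> f = lconst (\<theta>\<^sub>0 (f 0)) + (\<theta> (lconst 1 + g) - lconst 1)"
    using gl by (metis \<theta>_add \<theta>_diff \<theta>_lconst \<theta>_one laurent_add laurent_diff laurent_lmonom)
  then show ?thesis using a
    by (auto simp: starts_with_iff intro!: vanishes_below_add vanishes_below_diff)
qed

text \<open>
  The image of $y$ is a unit of nonnegative valuation.  If that valuation were 0, its constant term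
  $a$ would be an invertible element $\<theta>(c)$, and
  $c - y = c (1 - c^{-1} y)$ would have an image of valuation 0 although its constant term cancels.
\<close>
lemma image_y_positive:
  obtains a k where "a dvd 1" "k \<ge> 1" "starts_with (\<theta> (lmonom 1 1)) a k"
proof -
  let ?y = "lmonom 1 1 :: int \<Rightarrow> 'a"
  have one: "\<theta> ?y \<star>\<^bsub>D\<^esub> \<theta> (lmonom 1 (- 1)) = lconst 1"
    by (simp add: \<theta>_mult[symmetric])
  have nz: "\<theta> (lmonom 1 j) \<noteq> 0" for j
    by (simp add: \<theta>_eq_0_iff lmonom_1_nonzero)
  obtain a k where a: "a \<noteq> 0" "starts_with (\<theta> ?y) a k" using starts_with_exists[OF _ nz] by auto
  obtain b l where b: "b \<noteq> 0" "starts_with (\<theta> (lmonom 1 (- 1))) b l" using starts_with_exists[OF _ nz] by auto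
  have "starts_with (lconst 1) (a * b) (k + l)" using starts_with_mult[OF a(2) b(2)] one by simp
  then have "a * b = 1" using starts_with_unique(1)[of "lconst 1" "a * b" "k + l" 1 0] a b by simp
  then have a1: "a dvd 1" by (metis dvd_triv_left)
  have "vanishes_below 0 (\<theta> ?y)" by (rule image_nonneg) simp
  then have "k \<ge> 0" using a by (auto simp: starts_with_def vanishes_below_def not_less[symmetric])
  moreover have "k \<noteq> 0"
  proof
    assume "k = 0"
    obtain c where c: "\<tau> (lconst a) = lconst c" using \<tau>_const by blast
    obtain c' where c': "\<tau> (lconst b) = lconst c'" using \<tau>_const by blast
    have \<theta>c: "\<theta>\<^sub>0 c = a" "\<theta>\<^sub>0 c' = b"
      using \<theta>_\<tau>[of "lconst a"] \<theta>_\<tau>[of "lconst b"] by (simp_all add: c c' \<theta>_lconst)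
    interpret inv: const_automorphism D \<tau> \<theta> by (rule inverse_automorphism)
    have cc': "c * c' = 1"
      using inv.\<theta>_mult[of "lconst a" "lconst b"] \<open>a * b = 1\<close> by (simp add: c c')
    define f where "f = lmonom (- c') 1"
    obtain r where r: "r \<noteq> 0" "starts_with (\<theta> (lconst 1 + f)) r 0"
      by (rule image_one_plus[of f]) (auto simp: f_def)
    have "lconst c - ?y = lconst c \<star>\<^bsub>D\<^esub> (lconst 1 + f)"
      using cc' by (subst mult_const_left) (auto simp: f_def fun_eq_iff, auto simp: lmonom_def)
    then have "\<theta> (lconst c - ?y) = lconst a \<star>\<^bsub>D\<^esub> \<theta> (lconst 1 + f)"
      by (simp add: \<theta>_mult \<theta>_lconst \<theta>c f_def)
    then have "lconst a - \<theta> ?y = lconst a \<star>\<^bsub>D\<^esub> \<theta> (lconst 1 + f)"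
      by (simp add: \<theta>_diff \<theta>_lconst \<theta>c)
    moreover have "(lconst a - \<theta> ?y) 0 = 0" using a(2) \<open>k = 0\<close> by (simp add: starts_with_def lmonom_def)
    moreover have "(lconst a \<star>\<^bsub>D\<^esub> \<theta> (lconst 1 + f)) 0 = a * r"
      using starts_with_mult[OF starts_with_lmonom r(2), of a 0] by (simp add: starts_with_def)
    ultimately show False using a(1) r(1) by simp
  qed
  ultimately show thesis using that[OF a1 _ a(2)] by simp
qed

text \<open>
  If the image of $y$ had valuation at least 2, it would be $g y^2$ with $g$ of nonnegative
  valuation, and applying the inverse automorphism would give $y = \<tau>(g) \<tau>(y)^2$, of valuation at
  least 2.
\<close>
lemma image_y: obtains a where "a dvd 1" "starts_with (\<theta> (lmonom 1 1)) a 1"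
proof -
  let ?y = "lmonom 1 1 :: int \<Rightarrow> 'a"
  obtain a k where a: "a dvd 1" "k \<ge> 1" "starts_with (\<theta> ?y) a k" by (rule image_y_positive)
  interpret inv: const_automorphism D \<tau> \<theta> by (rule inverse_automorphism)
  obtain b l where b: "l \<ge> 1" "starts_with (\<tau> ?y) b l" by (rule inv.image_y_positive)
  have "k = 1"
  proof (rule ccontr)
    assume "k \<noteq> 1"
    then have "vanishes_below (2 + - 2) (\<theta> ?y \<star>\<^bsub>D\<^esub> lmonom 1 (- 2))"
      using a by (intro mult_bound vanishes_below_lmonom) (auto simp: starts_with_def vanishes_below_def)
    then have 1: "vanishes_below 0 (\<tau> (\<theta> ?y \<star>\<^bsub>D\<^esub> lmonom 1 (- 2)))" by (intro inv.image_nonneg) simp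
    have 2: "vanishes_below 1 (\<tau> ?y)" using b by (auto simp: starts_with_def vanishes_below_def)
    have "?y = \<tau> ((\<theta> ?y \<star>\<^bsub>D\<^esub> lmonom 1 (- 2)) \<star>\<^bsub>D\<^esub> (?y \<star>\<^bsub>D\<^esub> ?y))"
      by (simp add: mult_assoc \<tau>_\<theta>)
    also have "\<dots> = \<tau> (\<theta> ?y \<star>\<^bsub>D\<^esub> lmonom 1 (- 2)) \<star>\<^bsub>D\<^esub> (\<tau> ?y \<star>\<^bsub>D\<^esub> \<tau> ?y)"
      by (simp only: inv.\<theta>_mult mult_laurent \<theta>_laurent laurent_lmonom)
    finally have "vanishes_below (0 + (1 + 1)) ?y"
      using mult_bound[OF 1 mult_bound[OF 2 2]] by simp
    then show False using vanishes_belowD[of 2 ?y 1] by (simp add: lmonom_def)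
  qed
  then show thesis using that a by blast
qed

text \<open>
  The bound is known for valuation 0.  It propagates upwards with $y$ and downwards with $y^{-1}$,
  as their images have valuations 1 and $-1$.
\<close>
lemma \<theta>_filtered: "filtered_additive 0 \<theta>"
proof (rule filtered_additiveI)
  let ?y = "lmonom 1 1 :: int \<Rightarrow> 'a" and ?y' = "lmonom 1 (- 1) :: int \<Rightarrow> 'a"
  obtain a where a: "a dvd 1" "starts_with (\<theta> ?y) a 1" by (rule image_y)
  have y: "vanishes_below 1 (\<theta> ?y)" using a by (simp add: starts_with_iff)
  have "\<theta> ?y' \<noteq> 0" by (simp add: \<theta>_eq_0_iff lmonom_1_nonzero)
  then obtain b l where b: "b \<noteq> 0" "starts_with (\<theta> ?y') b l" using starts_with_exists[of "\<theta> ?y'"] by auto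
  have "starts_with (lconst 1) (a * b) (1 + l)"
    using starts_with_mult[OF a(2) b(2)] by (simp add: \<theta>_mult[symmetric])
  moreover have "a \<noteq> 0" using a(1) by auto
  ultimately have "1 + l = 0" using starts_with_unique(2)[of "lconst 1" "a * b" "1 + l" 1 0] b(1) by simp
  then have "l = - 1" by simp
  then have y': "vanishes_below (- 1) (\<theta> ?y')" using b(2) by (simp add: starts_with_iff)
  fix m and f :: "int \<Rightarrow> 'a"
  have "\<forall>f. vanishes_below m f \<longrightarrow> vanishes_below m (\<theta> f)"
  proof (induction m rule: int_induct[where k = 0])
    case base
    then show ?case using image_nonneg by blast
  next
    case (step1 m)
    show ?case
    proof (intro allI impI)
      fix f :: "int \<Rightarrow> 'a" assume f: "vanishes_below (m + 1) f"
      then have fl: "f \<in> laurent_series" by auto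
      have "vanishes_below (m + 1 + - 1) (f \<star>\<^bsub>D\<^esub> ?y')" by (rule mult_bound[OF f]) simp
      then have "vanishes_below m (\<theta> (f \<star>\<^bsub>D\<^esub> ?y'))" using step1 by simp
      from mult_bound[OF this y] show "vanishes_below (m + 1) (\<theta> f)"
        using fl by (simp add: \<theta>_mult[symmetric] mult_assoc)
    qed
  next
    case (step2 m)
    show ?case
    proof (intro allI impI)
      fix f :: "int \<Rightarrow> 'a" assume f: "vanishes_below (m - 1) f"
      then have fl: "f \<in> laurent_series" by auto
      have "vanishes_below (m - 1 + 1) (f \<star>\<^bsub>D\<^esub> ?y)" by (rule mult_bound[OF f]) simp
      then have "vanishes_below m (\<theta> (f \<star>\<^bsub>D\<^esub> ?y))" using step2 by simp
      from mult_bound[OF this y'] show "vanishes_below (m - 1) (\<theta> f)"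
        using fl by (simp add: \<theta>_mult[symmetric] mult_assoc)
    qed
  qed
  then show "vanishes_below m f \<Longrightarrow> vanishes_below (m + 0) (\<theta> f)" by simp
qed (rule \<theta>_add)

end

section \<open>Invariants of an automorphism fixing the new variable\<close>

locale invariant_substitution = skew_substitution \<delta> \<Delta> v \<epsilon> + A: const_automorphism \<delta> \<theta> \<tau>
  for \<delta> \<Delta> :: "'a::{idom, ring_char_0} \<Rightarrow> 'a" and v \<epsilon> \<theta> \<tau> +
  assumes v_invariant: "\<theta> v = v"
begin

lemma V_invariant: "\<theta> (V i) = V i"
proof -
  have minus: "\<theta> (V (- i)) = V (- i)" if "\<theta> (V i) = V i" for i
  proof -
    have "\<theta> (V (- i)) \<star>\<^bsub>\<delta>\<^esub> V i = lconst 1"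
      using A.\<theta>_mult[of "V (- i)" "V i"] V_add[of "- i" i, symmetric] that by (simp add: V_0[simplified])
    then have "(\<theta> (V (- i)) \<star>\<^bsub>\<delta>\<^esub> V i) \<star>\<^bsub>\<delta>\<^esub> V (- i) = V (- i)" by simp
    then show ?thesis using V_add[of i "- i", symmetric] by (simp add: C.mult_assoc V_0[simplified])
  qed
  have 1: "\<theta> (V 1) = V 1" by (simp add: V_1 v_invariant)
  have add: "\<theta> (V (i + j)) = V (i + j)" if "\<theta> (V i) = V i" "\<theta> (V j) = V j" for i j
    using that by (simp add: V_add A.\<theta>_mult)
  show ?thesis
  proof (induction i rule: int_induct[where k = 0])
    case base
    show ?case unfolding V_0 by (rule A.\<theta>_one)
  next
    case (step1 i)
    then show ?case using add 1 by blast
  next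
    case (step2 i)
    then show ?case using add[OF _ minus[OF 1], of i] by simp
  qed
qed

text \<open>
  Both sides are continuous in \<open>f\<close>, and \<open>\<theta>\<close> fixes the powers of \<open>v\<close>, so monomials suffice.
\<close>
lemma subst_equivariant:
  assumes f: "f \<in> laurent_series"
  shows "\<theta> (\<Phi> f) = \<Phi> (\<lambda>n. A.\<theta>\<^sub>0 (f n))"
proof (rule filtered_additive_ext[OF _ _ _ f])
  show "filtered_additive (0 + 0) (\<lambda>f. \<theta> (\<Phi> f))"
    by (rule filtered_additive_comp[OF A.\<theta>_filtered subst_filtered])
  have "filtered_additive 0 (\<lambda>f n. A.\<theta>\<^sub>0 (f n))"
    by (rule filtered_additiveI) (simp_all add: fun_eq_iff A.\<theta>\<^sub>0_add vanishes_below_def)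
  then show "filtered_additive (0 + 0) (\<lambda>f. \<Phi> (\<lambda>n. A.\<theta>\<^sub>0 (f n)))"
    by (rule filtered_additive_comp[OF subst_filtered])
  fix a j
  have "(\<lambda>n. A.\<theta>\<^sub>0 (lmonom a j n)) = lmonom (A.\<theta>\<^sub>0 a) j" by (auto simp: lmonom_def)
  then show "\<theta> (\<Phi> (lmonom a j)) = \<Phi> (\<lambda>n. A.\<theta>\<^sub>0 (lmonom a j n))"
    by (simp add: subst_monom A.\<theta>_mult A.\<theta>_lconst V_invariant)
qed

lemma subst_invariant_iff:
  assumes f: "f \<in> laurent_series"
  shows "\<theta> (\<Phi> f) = \<Phi> f \<longleftrightarrow> (\<forall>n. \<theta> (lconst (f n)) = lconst (f n))"
proof -
  obtain m where "vanishes_below m f" using f by (rule laurentE)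
  then have "vanishes_below m (\<lambda>n. A.\<theta>\<^sub>0 (f n))" by (simp add: vanishes_below_def)
  then have "(\<lambda>n. A.\<theta>\<^sub>0 (f n)) \<in> laurent_series" by (rule laurentI)
  then have "\<Phi> (\<lambda>n. A.\<theta>\<^sub>0 (f n)) = \<Phi> f \<longleftrightarrow> (\<lambda>n. A.\<theta>\<^sub>0 (f n)) = f"
    using bij_betw_imp_inj_on[OF subst_bij] f by (auto simp: inj_on_def)
  moreover have "(\<lambda>n. A.\<theta>\<^sub>0 (f n)) = f \<longleftrightarrow> (\<forall>n. \<theta> (lconst (f n)) = lconst (f n))"
    unfolding A.\<theta>_lconst lmonom_inject by (rule fun_eq_iff)
  ultimately show ?thesis unfolding subst_equivariant[OF f] by (rule trans)
qed

end

section \<open>The invariant Laurent series of a group action\<close>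

lemma automorphism_of_action:
  assumes "skew_full D" and G: "group G"
    and action: "right_action_by_automorphisms G (skew_laurent UNIV D) act"
    and stabilizes: "stabilizes G (skew_laurent UNIV D) act (range lconst)"
    and \<gamma>: "\<gamma> \<in> carrier G"
  shows "const_automorphism D (\<lambda>f. act f \<gamma>) (\<lambda>f. act f (inv\<^bsub>G\<^esub> \<gamma>))"
proof -
  interpret skew_full D by fact
  interpret G: group G by fact
  have hom: "(\<lambda>f. act f g) \<in> ring_hom C C" if "g \<in> carrier G" for g
    using action that by (auto simp: right_action_by_automorphisms_def ring_iso_def)
  have const: "\<exists>b. act (lconst a) g = lconst b" if "g \<in> carrier G" for a g
  proof -
    have "(\<lambda>f. act f g) \<in> ring_hom (C\<lparr>carrier := range lconst\<rparr>) (C\<lparr>carrier := range lconst\<rparr>)"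
      using stabilizes that by (auto simp: stabilizes_def ring_iso_def)
    from ring_hom_closed[OF this, of "lconst a"] show ?thesis by auto
  qed
  have comp: "act (act f g) g' = act f (g \<otimes>\<^bsub>G\<^esub> g')" "act f \<one>\<^bsub>G\<^esub> = f"
    if "f \<in> laurent_series" "g \<in> carrier G" "g' \<in> carrier G" for f g g'
    using action that by (auto simp: right_action_by_automorphisms_def carrier_eq)
  show ?thesis
    by unfold_locales (use \<gamma> in \<open>simp_all add: hom const comp\<close>)
qed

locale invariant_laurent = C: skew_full \<delta> + \<Gamma>: group \<Gamma>
  for \<delta> :: "'a::{idom, ring_char_0} \<Rightarrow> 'a" and \<Gamma> :: "('g, 'h) monoid_scheme" +
  fixes act :: "(int \<Rightarrow> 'a) \<Rightarrow> 'g \<Rightarrow> int \<Rightarrow> 'a" and e h :: 'a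
  assumes action: "right_action_by_automorphisms \<Gamma> C.C act"
    and stabilizes: "stabilizes \<Gamma> C.C act (range lconst)"
    and e_unit: "e dvd 1"
    and e_cocycle: "\<gamma> \<in> carrier \<Gamma> \<Longrightarrow>
      act (lconst e) \<gamma> = lconst (unit_inv (leading_cocycle act \<gamma>) * e)"
    and w_invariant: "lmonom (e\<^sup>2) (- 2) + lconst h \<in> invariants \<Gamma> C.C act"
begin

definition w :: "int \<Rightarrow> 'a" where
  "w = lmonom (e\<^sup>2) (- 2) + lconst h"

definition v :: "int \<Rightarrow> 'a" where
  "v = sqrt_starting_with C.C (unit_inv e) (inv\<^bsub>C.C\<^esub> w)"

definition \<Delta> :: "'a \<Rightarrow> 'a" where
  "\<Delta> = (\<lambda>f. e\<^sup>2 * \<delta> f)"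

abbreviation "R\<^sub>0 \<equiv> coeff_invariants \<Gamma> act"
abbreviation "e' \<equiv> unit_inv e"

lemma \<Delta>_add: "\<Delta> (a + b) = \<Delta> a + \<Delta> b"
  by (simp add: \<Delta>_def C.D_add algebra_simps)

lemma \<Delta>_mult: "\<Delta> (a * b) = \<Delta> a * b + a * \<Delta> b"
  by (simp add: \<Delta>_def C.D_mult algebra_simps)

sublocale C': skew_full \<Delta>
  by unfold_locales (simp_all add: C.S derivation_on_def \<Delta>_add \<Delta>_mult)

lemma automorphism:
  assumes "\<gamma> \<in> carrier \<Gamma>"
  shows "const_automorphism \<delta> (\<lambda>f. act f \<gamma>) (\<lambda>f. act f (inv\<^bsub>\<Gamma>\<^esub> \<gamma>))"
  using automorphism_of_action[OF C.skew_full_axioms \<Gamma>.group_axioms action stabilizes assms] .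

lemma w_starts: "starts_with w (e\<^sup>2) (- 2)" and w_laurent [simp]: "w \<in> laurent_series"
proof -
  show w: "starts_with w (e\<^sup>2) (- 2)" by (auto simp: w_def starts_with_def lmonom_def)
  then show "w \<in> laurent_series" by (rule starts_with_laurent)
qed

lemma w_inv: "w \<in> Units C.C" "starts_with (inv\<^bsub>C.C\<^esub> w) (e'\<^sup>2) (2 * 1)"
proof -
  have e2: "e\<^sup>2 dvd 1" using e_unit by (simp add: power2_eq_square mult_dvd_mono[of _ 1 _ 1, simplified])
  have e'2: "unit_inv (e\<^sup>2) = e'\<^sup>2"
    by (rule unit_inv_eqI) (simp add: power_mult_distrib[symmetric] unit_inv_right[OF e_unit])
  show "w \<in> Units C.C" "starts_with (inv\<^bsub>C.C\<^esub> w) (e'\<^sup>2) (2 * 1)"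
    using C.starts_with_unit_inverse[OF w_starts e2] by (simp_all add: e'2)
qed

lemma v_unique: "\<exists>!x. starts_with x e' 1 \<and> x \<star>\<^bsub>\<delta>\<^esub> x = inv\<^bsub>C.C\<^esub> w"
  by (rule C.square_root_unique[OF w_inv(2) unit_inv_unit[OF e_unit] C.two_unit])

lemma v_sqrt: "starts_with v e' 1" "v \<star>\<^bsub>\<delta>\<^esub> v = inv\<^bsub>C.C\<^esub> w" and v_laurent [simp]: "v \<in> laurent_series"
proof -
  have "v = (THE x. starts_with x e' 1 \<and> x \<star>\<^bsub>\<delta>\<^esub> x = inv\<^bsub>C.C\<^esub> w)"
    unfolding v_def sqrt_starting_with_def C.C_sel C.carrier_eq
    by (rule arg_cong[where f = The]) (auto simp: fun_eq_iff dest: starts_with_laurent)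
  then show "starts_with v e' 1" "v \<star>\<^bsub>\<delta>\<^esub> v = inv\<^bsub>C.C\<^esub> w"
    using theI'[OF v_unique] by auto
  then show "v \<in> laurent_series" by (blast intro: starts_with_laurent)
qed

lemma w_commutation: "w \<star>\<^bsub>\<delta>\<^esub> lconst a = lconst a \<star>\<^bsub>\<delta>\<^esub> w - lconst (2 * \<Delta> a)"
proof -
  have w_add: "(f + g) \<star>\<^bsub>\<delta>\<^esub> lconst a = f \<star>\<^bsub>\<delta>\<^esub> lconst a + g \<star>\<^bsub>\<delta>\<^esub> lconst a"
    if "f \<in> laurent_series" "g \<in> laurent_series" for f g
    using filtered_additive_add[OF C.filtered_additive_mult_right[of 0 "lconst a"], of f g] that by simp
  have "lmonom (e\<^sup>2) (- 2) \<star>\<^bsub>\<delta>\<^esub> lconst a = lconst (e\<^sup>2) \<star>\<^bsub>\<delta>\<^esub> (lmonom 1 (- 2) \<star>\<^bsub>\<delta>\<^esub> lconst a)"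
    by (simp add: C.mult_assoc[symmetric])
  also have "\<dots> = lmonom (e\<^sup>2 * a) (- 2) - lconst (2 * \<Delta> a)"
    by (simp add: C.y_inv_square_commutation C.mult_diff_right \<Delta>_def mult_ac)
  finally have "w \<star>\<^bsub>\<delta>\<^esub> lconst a = lmonom (e\<^sup>2 * a) (- 2) - lconst (2 * \<Delta> a) + lconst (h * a)"
    by (simp add: w_def w_add)
  moreover have "lconst a \<star>\<^bsub>\<delta>\<^esub> w = lmonom (e\<^sup>2 * a) (- 2) + lconst (h * a)"
    by (subst C.mult_const_left[OF w_laurent]) (simp add: w_def fun_eq_iff, simp add: lmonom_def algebra_simps)
  ultimately show ?thesis by simp
qed

sublocale skew_substitution \<delta> \<Delta> v e'
  by unfold_locales
     (simp_all add: v_sqrt unit_inv_unit[OF e_unit] C.Units_inv_inv[OF w_inv(1)] w_commutation)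

lemma w_fixed: "\<gamma> \<in> carrier \<Gamma> \<Longrightarrow> act w \<gamma> = w"
  using w_invariant by (simp add: invariants_def w_def)

text \<open>
  Both $v$ and its image are square roots of $w^{-1}$, and the cocycle condition on $e$ gives them the
  same leading coefficient: $\<theta>(e^{-1}) s_\<gamma>^{-1} = s_\<gamma> e^{-1} s_\<gamma>^{-1} = e^{-1}$.
\<close>
lemma v_fixed:
  assumes \<gamma>: "\<gamma> \<in> carrier \<Gamma>"
  shows "act v \<gamma> = v"
proof -
  interpret A: const_automorphism \<delta> "\<lambda>f. act f \<gamma>" "\<lambda>f. act f (inv\<^bsub>\<Gamma>\<^esub> \<gamma>)" by (rule automorphism[OF \<gamma>])
  obtain a where a: "a dvd 1" "starts_with (act (lmonom 1 1) \<gamma>) a 1" by (rule A.image_y)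
  \<comment> \<open>The cocycle takes the inverse of the leading coefficient of the image of y, and this
    coefficient a is a unit.\<close>
  have "leading_cocycle act \<gamma> = unit_inv a" unfolding leading_cocycle_def
  proof (rule the_equality)
    have "unit_inv (unit_inv a) = a" by (rule unit_inv_eqI) (rule unit_inv_left[OF a(1)])
    then show "unit_inv a dvd 1 \<and> starts_with (act (lmonom 1 1) \<gamma>) (unit_inv (unit_inv a)) 1"
      using a unit_inv_unit by simp
    fix u assume u: "u dvd 1 \<and> starts_with (act (lmonom 1 1) \<gamma>) (unit_inv u) 1"
    then have "unit_inv u = a" using a by (simp add: starts_with_def)
    then have "a * u = 1" using u unit_inv_left by auto
    then show "u = unit_inv a" by (metis unit_inv_eqI)
  qed
  then have "unit_inv (leading_cocycle act \<gamma>) = a" by (metis unit_inv_eqI unit_inv_left a(1))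
  then have \<theta>e: "A.\<theta>\<^sub>0 e = a * e" using e_cocycle[OF \<gamma>] by (simp add: A.\<theta>_lconst)
  have "A.\<theta>\<^sub>0 e' * (a * e) = 1"
    using A.\<theta>\<^sub>0_mult[of e' e] by (simp add: \<theta>e unit_inv_left[OF e_unit])
  then have "e * (A.\<theta>\<^sub>0 e' * a) = 1" by (simp add: mult_ac)
  then have e'_fixed: "A.\<theta>\<^sub>0 e' * a = e'" by (metis unit_inv_eqI)
  define r where "r = v - lmonom e' 1"
  have r: "vanishes_below (1 + 1) r"
    by (rule vanishes_below_Suc) (use v_sqrt(1) in \<open>auto simp: r_def starts_with_def vanishes_below_def lmonom_def\<close>)
  then have rl: "r \<in> laurent_series" by auto
  have "v = lconst e' \<star>\<^bsub>\<delta>\<^esub> lmonom 1 1 + r" by (simp add: r_def)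
  then have "act v \<gamma> = lconst (A.\<theta>\<^sub>0 e') \<star>\<^bsub>\<delta>\<^esub> act (lmonom 1 1) \<gamma> + act r \<gamma>"
    using rl A.\<theta>_add[of "lconst e' \<star>\<^bsub>\<delta>\<^esub> lmonom 1 1" r] A.\<theta>_mult[of "lconst e'" "lmonom 1 1"]
    by (simp add: A.\<theta>_lconst)
  moreover have "starts_with (lconst (A.\<theta>\<^sub>0 e') \<star>\<^bsub>\<delta>\<^esub> act (lmonom 1 1) \<gamma>) e' 1"
    using C.starts_with_mult[OF starts_with_lmonom a(2), of "A.\<theta>\<^sub>0 e'" 0] by (simp add: e'_fixed)
  moreover have "vanishes_below 2 (act r \<gamma>)" using filtered_additive_bound[OF A.\<theta>_filtered r] by simp
  ultimately have 1: "starts_with (act v \<gamma>) e' 1"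
    by (simp add: starts_with_def vanishes_below_def)
  have w_inverse: "inv\<^bsub>C.C\<^esub> w \<star>\<^bsub>\<delta>\<^esub> w = lconst 1" "w \<star>\<^bsub>\<delta>\<^esub> inv\<^bsub>C.C\<^esub> w = lconst 1"
    using C.Units_l_inv[OF w_inv(1)] C.Units_r_inv[OF w_inv(1)] by (simp_all add: C.C_sel)
  have w_inv_laurent: "inv\<^bsub>C.C\<^esub> w \<in> laurent_series" using w_inv(2) by (rule starts_with_laurent)
  have "act (inv\<^bsub>C.C\<^esub> w) \<gamma> \<star>\<^bsub>\<delta>\<^esub> w = lconst 1"
    using A.\<theta>_mult[OF w_inv_laurent w_laurent] w_inverse by (simp add: w_fixed[OF \<gamma>])
  then have "act (inv\<^bsub>C.C\<^esub> w) \<gamma> = inv\<^bsub>C.C\<^esub> w"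
    using C.inv_unique[of "act (inv\<^bsub>C.C\<^esub> w) \<gamma>" w "inv\<^bsub>C.C\<^esub> w"] w_inverse w_inv_laurent
    by (simp add: C.C_sel C.carrier_eq)
  then have "act v \<gamma> \<star>\<^bsub>\<delta>\<^esub> act v \<gamma> = inv\<^bsub>C.C\<^esub> w" using A.\<theta>_mult[OF v_laurent v_laurent] v_sqrt(2) by simp
  then show ?thesis using v_unique 1 v_sqrt by blast
qed

lemma coeff_invariant_iff: "r \<in> R\<^sub>0 \<longleftrightarrow> (\<forall>\<gamma>\<in>carrier \<Gamma>. act (lconst r) \<gamma> = lconst r)"
  by (simp add: coeff_invariants_def)

text \<open>
  The invariant element $w$ recovers \<open>\<Delta>\<close> from the multiplication: $2 \<Delta>(a) = a w - w a$.
\<close>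
lemma \<Delta>_closed:
  assumes a: "a \<in> R\<^sub>0"
  shows "\<Delta> a \<in> R\<^sub>0"
  unfolding coeff_invariant_iff
proof
  fix \<gamma> assume \<gamma>: "\<gamma> \<in> carrier \<Gamma>"
  interpret A: const_automorphism \<delta> "\<lambda>f. act f \<gamma>" "\<lambda>f. act f (inv\<^bsub>\<Gamma>\<^esub> \<gamma>)" by (rule automorphism[OF \<gamma>])
  have fix_a: "act (lconst a) \<gamma> = lconst a" using a \<gamma> by (simp add: coeff_invariant_iff)
  have eq: "lconst (2 * \<Delta> a) = lconst a \<star>\<^bsub>\<delta>\<^esub> w - w \<star>\<^bsub>\<delta>\<^esub> lconst a" by (simp add: w_commutation)
  have "act (lconst (2 * \<Delta> a)) \<gamma> = lconst (2 * \<Delta> a)"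
    unfolding eq by (simp add: A.\<theta>_diff A.\<theta>_mult fix_a w_fixed[OF \<gamma>])
  then have "A.\<theta>\<^sub>0 (2 * \<Delta> a) = 2 * \<Delta> a" by (simp add: A.\<theta>_lconst)
  then have "2 * A.\<theta>\<^sub>0 (\<Delta> a) = 2 * \<Delta> a" by (simp only: mult_2 A.\<theta>\<^sub>0_add)
  then show "act (lconst (\<Delta> a)) \<gamma> = lconst (\<Delta> a)" by (simp add: A.\<theta>_lconst)
qed

lemma derivation_restricts: "derivation_on R\<^sub>0 \<Delta>"
  by (simp add: derivation_on_def \<Delta>_add \<Delta>_mult \<Delta>_closed)

lemma subst_fixed_iff:
  assumes f: "f \<in> laurent_series" and \<gamma>: "\<gamma> \<in> carrier \<Gamma>"
  shows "act (\<Phi> f) \<gamma> = \<Phi> f \<longleftrightarrow> (\<forall>n. act (lconst (f n)) \<gamma> = lconst (f n))"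
proof -
  interpret A: const_automorphism \<delta> "\<lambda>f. act f \<gamma>" "\<lambda>f. act f (inv\<^bsub>\<Gamma>\<^esub> \<gamma>)" by (rule automorphism[OF \<gamma>])
  interpret I: invariant_substitution \<delta> \<Delta> v e' "\<lambda>f. act f \<gamma>" "\<lambda>f. act f (inv\<^bsub>\<Gamma>\<^esub> \<gamma>)"
    by unfold_locales (rule v_fixed[OF \<gamma>])
  show ?thesis by (rule I.subst_invariant_iff[OF f])
qed

lemma subst_ring_iso:
  "\<Phi> \<in> ring_iso (skew_laurent R\<^sub>0 \<Delta>) (C.C\<lparr>carrier := invariants \<Gamma> C.C act\<rparr>)"
proof -
  have carrier: "carrier (skew_laurent R\<^sub>0 \<Delta>) = {f \<in> laurent_series. range f \<subseteq> R\<^sub>0}"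
    by (auto simp: skew_laurent_def laurent_series_def vanishes_below_def)
  have invariant_iff: "\<Phi> f \<in> invariants \<Gamma> C.C act \<longleftrightarrow> f \<in> carrier (skew_laurent R\<^sub>0 \<Delta>)"
    if f: "f \<in> laurent_series" for f
    using f by (auto simp: invariants_def carrier C.carrier_eq subst_fixed_iff coeff_invariant_iff image_subset_iff)
  have sub: "invariants \<Gamma> C.C act \<subseteq> laurent_series"
    by (auto simp: invariants_def C.carrier_eq)
  show "\<Phi> \<in> ring_iso (skew_laurent R\<^sub>0 \<Delta>) (C.C\<lparr>carrier := invariants \<Gamma> C.C act\<rparr>)"
    unfolding ring_iso_def
  proof (intro CollectI conjI)
    have sel: "f \<otimes>\<^bsub>skew_laurent R\<^sub>0 \<Delta>\<^esub> g = f \<star>\<^bsub>\<Delta>\<^esub> g" "\<one>\<^bsub>skew_laurent R\<^sub>0 \<Delta>\<^esub> = lconst 1"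
      "f \<oplus>\<^bsub>skew_laurent R\<^sub>0 \<Delta>\<^esub> g = f + g" for f g
      by (simp_all add: skew_laurent_def lmonom_def plus_fun_def)
    show "\<Phi> \<in> ring_hom (skew_laurent R\<^sub>0 \<Delta>) (C.C\<lparr>carrier := invariants \<Gamma> C.C act\<rparr>)"
    proof (rule ring_hom_memI)
      fix f assume "f \<in> carrier (skew_laurent R\<^sub>0 \<Delta>)"
      then show "\<Phi> f \<in> carrier (C.C\<lparr>carrier := invariants \<Gamma> C.C act\<rparr>)"
        using invariant_iff by (simp add: carrier)
    next
      fix f g assume "f \<in> carrier (skew_laurent R\<^sub>0 \<Delta>)" "g \<in> carrier (skew_laurent R\<^sub>0 \<Delta>)"
      then have fg: "f \<in> laurent_series" "g \<in> laurent_series" by (auto simp: carrier)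
      show "\<Phi> (f \<otimes>\<^bsub>skew_laurent R\<^sub>0 \<Delta>\<^esub> g) = \<Phi> f \<otimes>\<^bsub>C.C\<lparr>carrier := invariants \<Gamma> C.C act\<rparr>\<^esub> \<Phi> g"
        using subst_mult[OF fg] by (simp add: sel C.C_sel)
      show "\<Phi> (f \<oplus>\<^bsub>skew_laurent R\<^sub>0 \<Delta>\<^esub> g) = \<Phi> f \<oplus>\<^bsub>C.C\<lparr>carrier := invariants \<Gamma> C.C act\<rparr>\<^esub> \<Phi> g"
        using filtered_additive_add[OF subst_filtered fg] by (simp add: sel C.C_sel)
    next
      show "\<Phi> \<one>\<^bsub>skew_laurent R\<^sub>0 \<Delta>\<^esub> = \<one>\<^bsub>C.C\<lparr>carrier := invariants \<Gamma> C.C act\<rparr>\<^esub>"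
        by (simp add: sel C.C_sel subst_const)
    qed
    have "\<Phi> ` carrier (skew_laurent R\<^sub>0 \<Delta>) = invariants \<Gamma> C.C act"
    proof (intro subset_antisym subsetI)
      fix g assume g: "g \<in> invariants \<Gamma> C.C act"
      then obtain f where f: "f \<in> laurent_series" "\<Phi> f = g" using sub subst_ex1[of g] by blast
      then show "g \<in> \<Phi> ` carrier (skew_laurent R\<^sub>0 \<Delta>)" using invariant_iff[OF f(1)] g by blast
    qed (use invariant_iff in \<open>auto simp: carrier\<close>)
    moreover have "inj_on \<Phi> (carrier (skew_laurent R\<^sub>0 \<Delta>))"
      by (rule inj_on_subset[OF bij_betw_imp_inj_on[OF subst_bij]]) (auto simp: carrier)
    ultimately show "bij_betw \<Phi> (carrier (skew_laurent R\<^sub>0 \<Delta>)) (carrier (C.C\<lparr>carrier := invariants \<Gamma> C.C act\<rparr>))"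
      by (simp add: bij_betw_def)
  qed
qed

end

theorem theorem1p3p2:
  fixes d \<delta> \<Delta> :: "'a::{idom, ring_char_0} \<Rightarrow> 'a"
    and C :: "(int \<Rightarrow> 'a) ring"
    and \<Gamma> :: "('g, 'h) monoid_scheme"
    and act :: "(int \<Rightarrow> 'a) \<Rightarrow> 'g \<Rightarrow> int \<Rightarrow> 'a"
    and s :: "'g \<Rightarrow> 'a"
    and w v :: "int \<Rightarrow> 'a"
    and e h :: 'a
  defines "C \<equiv> skew_laurent UNIV \<delta>"
    and "s \<equiv> leading_cocycle act"
    and "w \<equiv> lmonom (e\<^sup>2) (-2) \<oplus>\<^bsub>C\<^esub> lconst h"
    and "v \<equiv> sqrt_starting_with C (unit_inv e) (inv\<^bsub>C\<^esub> w)"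
    and "\<Delta> \<equiv> \<lambda>f. e\<^sup>2 * \<delta> f"
  assumes contains_rationals: "\<And>n::nat. n > 0 \<Longrightarrow> (of_nat n :: 'a) dvd 1"
    and derivation: "derivation_on UNIV d"
    and derivation_nonzero: "\<exists>f. d f \<noteq> 0"
    and half: "\<And>f. 2 * \<delta> f = d f"
    and group: "group \<Gamma>"
    and action: "right_action_by_automorphisms \<Gamma> C act"
    and stabilizes: "stabilizes \<Gamma> C act (range lconst)"
    and e_unit: "e dvd 1"
    and e_cocycle: "\<And>\<gamma>. \<gamma> \<in> carrier \<Gamma> \<Longrightarrow> act (lconst e) \<gamma> = lconst (unit_inv (s \<gamma>) * e)"
    and w_invariant: "w \<in> invariants \<Gamma> C act"
  shows "derivation_on (coeff_invariants \<Gamma> act) \<Delta> \<and>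
    laurent_subst C v \<in>
      ring_iso (skew_laurent (coeff_invariants \<Gamma> act) \<Delta>) (C\<lparr>carrier := invariants \<Gamma> C act\<rparr>)"
proof -
  have Q: "rational_subring (UNIV :: 'a set)"
    unfolding rational_subring_def using contains_rationals by (auto simp: dvd_def)
  have d: "d (a + b) = d a + d b" "d (a * b) = d a * b + a * d b" for a b
    using derivation by (auto simp: derivation_on_def)
  have \<delta>: "\<delta> (a + b) = \<delta> a + \<delta> b" "\<delta> (a * b) = \<delta> a * b + a * \<delta> b" for a b
  proof -
    have "2 * \<delta> (a + b) = 2 * (\<delta> a + \<delta> b)" "2 * \<delta> (a * b) = 2 * (\<delta> a * b + a * \<delta> b)"
      by (simp_all add: half d distrib_left mult.assoc[symmetric] mult.left_commute[of 2 a])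
    then show "\<delta> (a + b) = \<delta> a + \<delta> b" "\<delta> (a * b) = \<delta> a * b + a * \<delta> b"
      using mult_left_cancel[of "2 :: 'a"] by (metis zero_neq_numeral)+
  qed
  have full: "skew_full \<delta>"
    by unfold_locales (simp_all add: Q derivation_on_def \<delta>)
  have w_eq: "w = lmonom (e\<^sup>2) (- 2) + lconst h"
    unfolding w_def C_def by (rule skew_full.C_sel[OF full])
  have I: "invariant_laurent \<delta> \<Gamma> act e h"
    by (intro invariant_laurent.intro invariant_laurent_axioms.intro full group)
       (use action stabilizes e_unit e_cocycle w_invariant in \<open>simp_all add: C_def s_def w_eq\<close>)
  show ?thesis
    using invariant_laurent.derivation_restricts[OF I] invariant_laurent.subst_ring_iso[OF I]
    by (simp only: invariant_laurent.v_def[OF I] invariant_laurent.w_def[OF I] invariant_laurent.\<Delta>_def[OF I]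
        v_def w_eq \<Delta>_def C_def)
qed

end
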